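(* Let $\mu$ be a probability measure on $[a,b]$ with $\mu\ll\mathscr{L}$, $\frac{d\mu}{d\mathscr{L}}\in W^{1,1}$ and $0<\operatorname{ess\,inf}\frac{d\mu}{d\mathscr{L}}\le\operatorname{ess\,sup}\frac{d\mu}{d\mathscr{L}}<\infty$, and let $u_0\in W^{2,1}$. Then for any $t\ge0$ and any positive sequence $\alpha_k\to0$, the functionals $F_{\alpha_k}^{f^{tu_0}_{\alpha_k},\mu}$ $\Gamma$-converge to $F_0^{f_0^{tu_0},\mu}$ with respect to pointwise convergence on $\mathscr{H}$.
   Context: Fix reals $a<b$; function spaces are on $[a,b]$ and $\mathscr{L}$ is Lebesgue measure. The Helly space is $\mathscr{H}=\{\Phi:[a,b]\to[a,b]\ :\ \Phi \text{ monotone (non-decreasing)},\ \Phi(a)=a,\ \Phi(b)=b\}$ with the topology of pointwise convergence. $\mathsf{Ent}(\nu)=\int \frac{d\nu}{d\mathscr{L}}\log\frac{d\nu}{d\mathscr{L}}\,d\mathscr{L}$ if $\nu\ll\mathscr{L}$ and $+\infty$ otherwise. For $\alpha\ge0$, a linear functional $f$ and $\Phi\in\mathscr{H}$, $F_\alpha^{f,\mu}(\Phi)=\int_a^b\frac{(\Phi(x)-x)^2}{2}\,d\mu(x)+\alpha\,\mathsf{Ent}(\Phi_\#\mu)-f(\Phi)$, where for $\alpha=0$ the entropy term is absent. For a velocity $w$, $f_\alpha^{w}(\Phi)=\int_a^b \Phi\, w+\alpha\,\partial_x\Phi\,\partial_x w\,d\mu-\int_a^b\alpha\,\partial_x\Phi\,d\mu$.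 With $m=\frac{d\mu}{d\mathscr{L}}$, for $\Phi\in\mathscr{H}$ not weakly differentiable this is understood via integration by parts: $f_\alpha^w(\Phi)=\int_a^b\Phi\,[\,w m-\alpha\partial_x(m\,\partial_x w)+\alpha\,\partial_x m\,]\,dx+\alpha[m\,(\partial_x w)\Phi]_a^b-\alpha[m\Phi]_a^b$. In particular $f_0^{tu_0}(\Phi)=t\int_a^b\Phi u_0\,d\mu$. Functionals $F_n:X\to\mathbb{R}\cup\{\pm\infty\}$ on a first countable space $X$ $\Gamma$-converge to $F_*$ if (i) for all $x\in X$ and all sequences $x_n\to x$, $F_*(x)\le\liminf_n F_n(x_n)$; and (ii) for every $x\in X$ there is a sequence $x_n\to x$ with $F_*(x)\ge\limsup_n F_n(x_n)$. *)

theory Defs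
  imports "HOL-Probability.Probability"
begin

text \<open>Lebesgue measure on the interval; measures on the interval are measures on its Borel sets.\<close>

definition leb :: "real \<Rightarrow> real \<Rightarrow> real measure" where
  "leb a b = restrict_space lborel {a..b}"

definition dens :: "real \<Rightarrow> real \<Rightarrow> real measure \<Rightarrow> real \<Rightarrow> real" where
  "dens a b \<nu> x = enn2real (RN_deriv (leb a b) \<nu> x)"

definition essinf :: "'a measure \<Rightarrow> ('a \<Rightarrow> ereal) \<Rightarrow> ereal" where
  "essinf M f = (if f \<in> borel_measurable M then Liminf (ae_filter M) f else bot)"


subsection \<open>Sobolev functions on an interval\<close>

definition test_fun :: "real \<Rightarrow> real \<Rightarrow> (real \<Rightarrow> real) \<Rightarrow> bool" where
  "test_fun a b \<phi> \<longleftrightarrow>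
     (\<forall>k x. (deriv ^^ k) \<phi> differentiable (at x)) \<and>
     compact (closure {x. \<phi> x \<noteq> 0}) \<and> closure {x. \<phi> x \<noteq> 0} \<subseteq> {a<..<b}"

definition loc_integrable :: "real \<Rightarrow> real \<Rightarrow> (real \<Rightarrow> real) \<Rightarrow> bool" where
  "loc_integrable a b f \<longleftrightarrow> (\<forall>c d. a < c \<and> d < b \<longrightarrow> set_integrable lborel {c..d} f)"

definition has_weak_deriv :: "real \<Rightarrow> real \<Rightarrow> (real \<Rightarrow> real) \<Rightarrow> (real \<Rightarrow> real) \<Rightarrow> bool" where
  "has_weak_deriv a b f g \<longleftrightarrow>
     loc_integrable a b f \<and> loc_integrable a b g \<and>
     (\<forall>\<phi>. test_fun a b \<phi> \<longrightarrow>
        (LINT x|leb a b. f x * deriv \<phi> x) = - (LINT x|leb a b. g x * \<phi> x))"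

definition weakly_differentiable :: "real \<Rightarrow> real \<Rightarrow> (real \<Rightarrow> real) \<Rightarrow> bool" where
  "weakly_differentiable a b f \<longleftrightarrow> (\<exists>g. has_weak_deriv a b f g)"

text \<open>Determined up to Lebesgue null sets, and only ever used under integrals or
  via its continuous representative.\<close>

definition weak_deriv :: "real \<Rightarrow> real \<Rightarrow> (real \<Rightarrow> real) \<Rightarrow> real \<Rightarrow> real" where
  "weak_deriv a b f = (SOME g. has_weak_deriv a b f g)"

text \<open>\<open>sobolev a b k\<close> is the space $W^{k,1}(a,b)$.\<close>

primrec sobolev :: "real \<Rightarrow> real \<Rightarrow> nat \<Rightarrow> (real \<Rightarrow> real) \<Rightarrow> bool" where
  "sobolev a b 0 f \<longleftrightarrow> integrable (leb a b) f"
| "sobolev a b (Suc k) f \<longleftrightarrow>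
     integrable (leb a b) f \<and> (\<exists>g. has_weak_deriv a b f g \<and> sobolev a b k g)"

text \<open>Boundary values of a $W^{1,1}$ function are those of its continuous representative on the
  closed interval.\<close>

definition cont_rep :: "real \<Rightarrow> real \<Rightarrow> (real \<Rightarrow> real) \<Rightarrow> real \<Rightarrow> real" where
  "cont_rep a b f = (SOME g. continuous_on {a..b} g \<and> (AE x in leb a b. g x = f x))"


subsection \<open>The Helly space\<close>

text \<open>Functions on the interval are represented by functions on the reals that are
  \<open>undefined\<close> outside of it; the product topology is pointwise convergence.\<close>

definition helly :: "real \<Rightarrow> real \<Rightarrow> (real \<Rightarrow> real) set" where
  "helly a b = {\<Phi> \<in> {a..b} \<rightarrow>\<^sub>E {a..b}. mono_on {a..b} \<Phi> \<and> \<Phi> a = a \<and> \<Phi> b = b}"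

definition helly_space :: "real \<Rightarrow> real \<Rightarrow> (real \<Rightarrow> real) topology" where
  "helly_space a b = subtopology (product_topology (\<lambda>_. euclideanreal) {a..b}) (helly a b)"


subsection \<open>The functionals\<close>

text \<open>The integral is the difference of the integrals of the positive and the negative part.
  The latter is finite since $r \log r \ge -1/e$, so no $\infty - \infty$ occurs.\<close>

definition Ent :: "real \<Rightarrow> real \<Rightarrow> real measure \<Rightarrow> ereal" where
  "Ent a b \<nu> =
     (if absolutely_continuous (leb a b) \<nu>
      then enn2ereal (\<integral>\<^sup>+x. ennreal (dens a b \<nu> x * ln (dens a b \<nu> x)) \<partial>leb a b)
         - enn2ereal (\<integral>\<^sup>+x. ennreal (- (dens a b \<nu> x * ln (dens a b \<nu> x))) \<partial>leb a b)
      else \<infinity>)"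

definition F_fun ::
  "real \<Rightarrow> real \<Rightarrow> real measure \<Rightarrow> real \<Rightarrow> ((real \<Rightarrow> real) \<Rightarrow> real) \<Rightarrow> (real \<Rightarrow> real) \<Rightarrow> ereal" where
  "F_fun a b \<mu> \<alpha> f \<Phi> =
     ereal (LINT x|\<mu>. (\<Phi> x - x)\<^sup>2 / 2)
     + (if \<alpha> = 0 then 0 else ereal \<alpha> * Ent a b (distr \<mu> (leb a b) \<Phi>))
     - ereal (f \<Phi>)"

text \<open>The weak derivative on the open interval does not see a jump of \<open>\<Phi>\<close> at an endpoint, and for
  such \<open>\<Phi>\<close> integration by parts with the prescribed values at \<open>a\<close> and \<open>b\<close> fails. Requiring continuity
  on the closed interval (automatic in the interior) for the first formula
  makes the two formulas agree wherever the first one is used, so that the functional is linear.\<close>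

definition f_fun ::
  "real \<Rightarrow> real \<Rightarrow> real measure \<Rightarrow> real \<Rightarrow> (real \<Rightarrow> real) \<Rightarrow> (real \<Rightarrow> real) \<Rightarrow> real" where
  "f_fun a b \<mu> \<alpha> w \<Phi> =
    (let m = dens a b \<mu>; dw = weak_deriv a b w in
     if weakly_differentiable a b \<Phi> \<and> continuous_on {a..b} \<Phi>
     then (LINT x|\<mu>. \<Phi> x * w x + \<alpha> * weak_deriv a b \<Phi> x * dw x)
          - (LINT x|\<mu>. \<alpha> * weak_deriv a b \<Phi> x)
     else (LINT x|leb a b. \<Phi> x *
             (w x * m x - \<alpha> * weak_deriv a b (\<lambda>y. m y * dw y) x + \<alpha> * weak_deriv a b m x))
          + \<alpha> * (cont_rep a b m b * cont_rep a b dw b * \<Phi> b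
                 - cont_rep a b m a * cont_rep a b dw a * \<Phi> a)
          - \<alpha> * (cont_rep a b m b * \<Phi> b - cont_rep a b m a * \<Phi> a))"


subsection \<open>Gamma-convergence\<close>

text \<open>The sequential notion, meant for first countable spaces.\<close>

definition gamma_converges ::
  "'a topology \<Rightarrow> (nat \<Rightarrow> 'a \<Rightarrow> ereal) \<Rightarrow> ('a \<Rightarrow> ereal) \<Rightarrow> bool" where
  "gamma_converges X F G \<longleftrightarrow>
     (\<forall>x \<in> topspace X. \<forall>xs. range xs \<subseteq> topspace X \<and> limitin X xs x sequentially \<longrightarrow>
        G x \<le> liminf (\<lambda>n. F n (xs n))) \<and>
     (\<forall>x \<in> topspace X. \<exists>xs. range xs \<subseteq> topspace X \<and> limitin X xs x sequentially \<and>
        G x \<ge> limsup (\<lambda>n. F n (xs n)))"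

end

theory Submission
  imports Defs
begin

text \<open>
  Both directions of the Gamma-convergence rest on one uniform estimate. Write $m$ for the density
  of \<open>\<mu>\<close> and \<open>w = t u0\<close>. On the whole Helly space the linear functional satisfies
  \[ | f_\alpha^w(\Phi) - \int \Phi\, w\, m \,dx | \le |\alpha|\, C \]
  with one constant \<open>C\<close> (lemma \<open>f_fun_perturbation\<close>). If \<open>\<Phi>\<close> is continuous and weakly
  differentiable, its weak derivative is nonnegative with integral at most \<open>b - a\<close>, while $m$ and
  $\partial_x w$ are bounded, so the terms with factor \<open>\<alpha>\<close> are bounded. Otherwise
  \<open>\<Phi>\<close> is bounded and $\partial_x(m\,\partial_x w)$ and $\partial_x m$ are integrable. The limit
  functional and the transport cost are continuous under pointwise convergence by dominated
  convergence, so only the entropy term remains.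

  For the lower bound, $r \log r \ge -1$ gives an entropy of at least \<open>-(b - a)\<close>; multiplied by
  \<open>\<alpha>\<close> it cannot lower the limit. For the recovery sequence, \<open>\<Phi>\<close> is mixed with the
  identity, \<open>\<Psi> x = (1 - \<delta>) \<Phi> x + \<delta> x\<close>. This map expands distances by at least the factor
  \<open>\<delta>\<close>, so it pushes a measure of density at most \<open>B\<close> to one of density at most
  \<open>B / \<delta>\<close> (lemma \<open>emeasure_distr_expanding_le\<close>), whose entropy is at most
  $(B/\delta)^2 (b-a)$. With \<open>\<delta>\<close> of order $\alpha^{1/4}$ the entropy term tends to zero.

  Most of the text develops one-dimensional Sobolev theory. Smooth bumps converge to indicators of
  intervals, which yields the fundamental lemma, hence uniqueness of weak derivatives, and the lemma
  of du Bois-Reymond. By the latter, a function with integrable weak derivative is almost everywhere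
  a constant plus a primitive; this gives its boundedness and, with Fubini's theorem, the product rule.
  Passing from intervals to Borel sets is done each time by a comparison principle for finite
  measures on the line.
\<close>

section \<open>Comparing finite measures on intervals\<close>

text \<open>The difference of the distribution functions is nondecreasing and right continuous, hence itself
  the distribution function of a finite measure \<open>\<kappa>\<close>. Then \<open>N = M + \<kappa>\<close> on half-open intervals
  and, by a Dynkin argument, on all Borel sets. A plain Dynkin argument for the inequality would
  fail at complements, which is why \<open>\<kappa>\<close> is introduced.\<close>

lemma finite_borel_measure_le_if_intervals_le:
  assumes M: "finite_borel_measure M" and N: "finite_borel_measure N"
    and le: "\<And>x y. x < y \<Longrightarrow> measure M {x<..y} \<le> measure N {x<..y}"
    and A: "A \<in> sets borel"
  shows "measure M A \<le> measure N A"
proof -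
  interpret M: finite_borel_measure M by fact
  interpret N: finite_borel_measure N by fact
  define D where "D = (\<lambda>x. cdf N x - cdf M x)"
  have mono: "D x \<le> D y" if "x \<le> y" for x y
    using le[of x y] that M.cdf_diff_eq[of x y] N.cdf_diff_eq[of x y]
    by (cases "x = y") (auto simp: D_def)
  have cont: "continuous (at_right x) D" for x
    unfolding D_def by (intro continuous_intros M.cdf_is_right_cont N.cdf_is_right_cont)
  have bot: "(D \<longlongrightarrow> 0) at_bot"
    unfolding D_def using tendsto_diff[OF N.cdf_lim_at_bot M.cdf_lim_at_bot] by simp
  have top: "(D \<longlongrightarrow> measure N (space N) - measure M (space M)) at_top"
    unfolding D_def by (intro tendsto_diff N.cdf_lim_at_top M.cdf_lim_at_top)
  have nonneg: "0 \<le> D x" for x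
    using bot by (rule tendsto_upperbound)
      (auto simp: eventually_at_bot_linorder mono intro!: exI[of _ x])
  have nonneg_top: "0 \<le> measure N (space N) - measure M (space M)"
    using top by (rule tendsto_lowerbound) (auto simp: nonneg)
  define \<kappa> where "\<kappa> = interval_measure D"
  have K: "finite_borel_measure \<kappa>"
    unfolding \<kappa>_def by (rule finite_borel_measure_interval_measure[OF mono cont bot top nonneg_top])
  interpret K: finite_borel_measure \<kappa> by fact
  have top_eq: "measure \<kappa> UNIV = measure N (space N) - measure M (space M)"
    unfolding \<kappa>_def
    by (rule measure_eq_emeasure_eq_ennreal[OF nonneg_top interval_measure_UNIV[OF mono cont bot top nonneg_top]])
  let ?G = "range (\<lambda>(x, y). {x<..y::real})"
  have borel: "sigma_sets UNIV ?G = sets borel"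
    by (subst borel_sigma_sets_Ioc) simp
  have "measure N A = measure M A + measure \<kappa> A"
  proof (rule sigma_sets_induct_disjoint[of ?G UNIV A])
    show "Int_stable ?G" by (auto simp: Int_stable_def)
    show "A \<in> sigma_sets UNIV ?G" using A borel by simp
  next
    fix B assume "B \<in> ?G"
    then obtain x y where B: "B = {x<..y}" by auto
    show "measure N B = measure M B + measure \<kappa> B"
    proof (cases "x < y")
      case True
      then have "measure \<kappa> B = D y - D x"
        unfolding B \<kappa>_def by (intro measure_interval_measure_Ioc mono cont) auto
      then show ?thesis
        using True M.cdf_diff_eq[of x y] N.cdf_diff_eq[of x y] by (simp add: B D_def)
    qed (simp add: B)
  next
    fix B assume B: "B \<in> sigma_sets UNIV ?G" "measure N B = measure M B + measure \<kappa> B"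
    then have "B \<in> sets borel" using borel by simp
    then show "measure N (UNIV - B) = measure M (UNIV - B) + measure \<kappa> (UNIV - B)"
      using B(2) top_eq M.finite_measure_compl[of B] N.finite_measure_compl[of B]
        K.finite_measure_compl[of B]
      by (simp add: M.M_is_borel N.M_is_borel K.M_is_borel M.borel_UNIV N.borel_UNIV K.borel_UNIV)
  next
    fix B :: "nat \<Rightarrow> real set"
    assume d: "disjoint_family B" and s: "range B \<subseteq> sigma_sets UNIV ?G"
      and e: "\<And>i. measure N (B i) = measure M (B i) + measure \<kappa> (B i)"
    have s: "range B \<subseteq> sets borel" using s borel by simp
    have "(\<lambda>i. measure M (B i)) sums measure M (\<Union>i. B i)"
      using s d by (intro M.finite_measure_UNION) (auto simp: M.M_is_borel)
    moreover have "(\<lambda>i. measure \<kappa> (B i)) sums measure \<kappa> (\<Union>i. B i)"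
      using s d by (intro K.finite_measure_UNION) (auto simp: K.M_is_borel)
    ultimately have "(\<lambda>i. measure N (B i)) sums (measure M (\<Union>i. B i) + measure \<kappa> (\<Union>i. B i))"
      unfolding e by (rule sums_add)
    moreover have "(\<lambda>i. measure N (B i)) sums measure N (\<Union>i. B i)"
      using s d by (intro N.finite_measure_UNION) (auto simp: N.M_is_borel)
    ultimately show "measure N (\<Union>i. B i) = measure M (\<Union>i. B i) + measure \<kappa> (\<Union>i. B i)"
      by (rule sums_unique2[rotated])
  qed auto
  then show ?thesis by simp
qed

text \<open>The comparison principle applied to the measures whose densities are the negative and the positive
  part of \<open>u\<close> extends nonnegativity of the integral from intervals to all Borel sets.\<close>

lemma AE_nonneg_if_interval_integrals_nonneg:
  fixes u :: "real \<Rightarrow> real"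
  assumes u: "integrable lborel u"
    and nonneg: "\<And>x y. x < y \<Longrightarrow> 0 \<le> (LINT t:{x<..y}|lborel. u t)"
  shows "AE x in lborel. 0 \<le> u x"
proof -
  have [measurable]: "u \<in> borel_measurable borel"
    using borel_measurable_integrable[OF u] by simp
  have dens: "finite_borel_measure (density lborel (\<lambda>x. ennreal (v x)))"
       "\<And>A. A \<in> sets borel \<Longrightarrow>
          measure (density lborel (\<lambda>x. ennreal (v x))) A = (LINT x:A|lborel. max 0 (v x))"
    if v: "integrable lborel v" for v :: "real \<Rightarrow> real"
  proof -
    have [measurable]: "v \<in> borel_measurable borel"
      using borel_measurable_integrable[OF v] by simp
    have em: "emeasure (density lborel (\<lambda>x. ennreal (v x))) A = ennreal (LINT x:A|lborel. max 0 (v x))"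
      if [measurable]: "A \<in> sets borel" for A
    proof -
      have "emeasure (density lborel (\<lambda>x. ennreal (v x))) A
          = (\<integral>\<^sup>+x. ennreal (indicator A x *\<^sub>R max 0 (v x)) \<partial>lborel)"
        by (subst emeasure_density)
           (auto intro!: nn_integral_cong simp: indicator_def max_def ennreal_neg)
      also have "\<dots> = ennreal (LINT x:A|lborel. max 0 (v x))"
        unfolding set_lebesgue_integral_def
        by (intro nn_integral_eq_integral integrable_mult_indicator integrable_max v) auto
      finally show ?thesis .
    qed
    show "finite_borel_measure (density lborel (\<lambda>x. ennreal (v x)))"
      by (intro finite_borel_measure.intro finite_measureI finite_borel_measure_axioms.intro)
         (simp_all add: em)
    show "measure (density lborel (\<lambda>x. ennreal (v x))) A = (LINT x:A|lborel. max 0 (v x))"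
      if [measurable]: "A \<in> sets borel" for A
      unfolding measure_def em[OF that]
      by (simp add: set_lebesgue_integral_def)
  qed
  have split: "(LINT x:A|lborel. max 0 (u x)) - (LINT x:A|lborel. max 0 (- u x)) = (LINT x:A|lborel. u x)"
    if [measurable]: "A \<in> sets borel" for A
  proof -
    have "set_integrable lborel A (\<lambda>x. max 0 (u x))" "set_integrable lborel A (\<lambda>x. max 0 (- u x))"
      unfolding set_integrable_def
      using u that by (intro integrable_mult_indicator integrable_max; simp)+
    then have "(LINT x:A|lborel. max 0 (u x)) - (LINT x:A|lborel. max 0 (- u x))
        = (LINT x:A|lborel. max 0 (u x) - max 0 (- u x))"
      by (rule set_integral_diff(2)[symmetric])
    also have "(\<lambda>x. max 0 (u x) - max 0 (- u x)) = u"
      by (auto simp: max_def)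
    finally show ?thesis .
  qed
  have mu: "integrable lborel (\<lambda>x. - u x)" using u by simp
  show ?thesis
  proof (rule sigma_finite_measure.density_nonneg[OF lborel.sigma_finite_measure_axioms u])
    fix A :: "real set" assume A: "A \<in> sets lborel"
    have "measure (density lborel (\<lambda>x. ennreal (- u x))) A \<le> measure (density lborel (\<lambda>x. ennreal (u x))) A"
    proof (rule finite_borel_measure_le_if_intervals_le[OF dens(1)[OF mu] dens(1)[OF u]])
      fix x y :: real assume "x < y"
      then show "measure (density lborel (\<lambda>x. ennreal (- u x))) {x<..y} \<le> measure (density lborel (\<lambda>x. ennreal (u x))) {x<..y}"
        using nonneg[of x y] split[of "{x<..y}"] by (simp add: dens(2)[OF u] dens(2)[OF mu])
    qed (use A in simp)
    then show "0 \<le> (LINT x:A|lborel. u x)"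
      using split[of A] A by (simp add: dens(2)[OF u] dens(2)[OF mu])
  qed
qed

section \<open>Smooth bump functions\<close>

text \<open>
  The classical smooth function that is flat at zero, \<open>exp (- 1 / y)\<close> for positive \<open>y\<close>, together with
  the multiples by powers of \<open>1 / y\<close> that appear when it is differentiated.
\<close>

definition flat_exp :: "nat \<Rightarrow> real \<Rightarrow> real" where
  "flat_exp k y = (if y > 0 then exp (- (1 / y)) / y ^ k else 0)"

lemma flat_exp_tendsto_0: "(flat_exp k \<longlongrightarrow> 0) (at 0)"
proof -
  have "((\<lambda>y::real. inverse y ^ k / exp (inverse y)) \<longlongrightarrow> 0) (at_right 0)"
    by (rule filterlim_compose[OF tendsto_power_div_exp_0 filterlim_inverse_at_top_right])
  then have "(flat_exp k \<longlongrightarrow> 0) (at_right 0)"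
    by (rule Lim_transform_eventually)
       (auto simp: eventually_at_right_field flat_exp_def field_simps exp_minus intro!: exI[of _ 1])
  moreover have "(flat_exp k \<longlongrightarrow> 0) (at_left 0)"
    by (rule Lim_transform_eventually[OF tendsto_const])
       (auto simp: eventually_at_left_field flat_exp_def intro!: exI[of _ "-1"])
  ultimately show ?thesis by (simp add: filterlim_split_at)
qed

text \<open>At zero the difference quotient of \<open>flat_exp k\<close> is \<open>flat_exp (k + 1)\<close>, which tends to zero.\<close>

lemma flat_exp_has_derivative:
  "(flat_exp k has_real_derivative (flat_exp (k + 2) y - real k * flat_exp (k + 1) y)) (at y)"
proof (cases y "0::real" rule: linorder_cases)
  case less
  have "((\<lambda>_. 0) has_real_derivative 0) (at y)" by simp
  then have "(flat_exp k has_real_derivative 0) (at y)"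
    by (rule has_field_derivative_transform_within_open[of _ _ _ "{..<0}"])
       (use less in \<open>auto simp: flat_exp_def\<close>)
  then show ?thesis using less by (simp add: flat_exp_def)
next
  case equal
  have "((\<lambda>h. (flat_exp k (0 + h) - flat_exp k 0) / h) \<longlongrightarrow> 0) (at 0)"
    by (rule Lim_transform_eventually[OF flat_exp_tendsto_0[of "Suc k"]])
       (auto simp: flat_exp_def eventually_at intro!: exI[of _ 1])
  then show ?thesis using equal by (simp add: DERIV_def flat_exp_def)
next
  case greater
  have "((\<lambda>y. exp (- (1 / y)) / y ^ k) has_real_derivative
         (flat_exp (k + 2) y - real k * flat_exp (k + 1) y)) (at y)"
    using greater
    apply (auto intro!: derivative_eq_intros simp: flat_exp_def)
    apply (cases k)
    apply (auto simp: field_simps power2_eq_square power_add)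
    done
  then show ?thesis
    by (rule has_field_derivative_transform_within_open[of _ _ _ "{0<..}"])
       (use greater in \<open>auto simp: flat_exp_def\<close>)
qed

text \<open>
  A class of functions that contains the derivative of each of its members, so that every member is
  smooth. Closing it under sums and products avoids a Leibniz formula for higher derivatives.
\<close>

inductive flat_alg :: "(real \<Rightarrow> real) \<Rightarrow> bool" where
  base: "flat_alg (\<lambda>x. c * flat_exp k (r * x + s))"
| add: "flat_alg f \<Longrightarrow> flat_alg g \<Longrightarrow> flat_alg (\<lambda>x. f x + g x)"
| mult: "flat_alg f \<Longrightarrow> flat_alg g \<Longrightarrow> flat_alg (\<lambda>x. f x * g x)"

lemma flat_alg_has_derivative:
  "flat_alg f \<Longrightarrow> \<exists>f'. flat_alg f' \<and> (\<forall>x. (f has_real_derivative f' x) (at x))"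
proof (induction rule: flat_alg.induct)
  case (base c k r s)
  have "((\<lambda>x. c * flat_exp k (r * x + s)) has_real_derivative
      (c * r) * flat_exp (k + 2) (r * x + s) + (- c * r * real k) * flat_exp (k + 1) (r * x + s)) (at x)" for x
    by (rule derivative_eq_intros DERIV_chain2[OF flat_exp_has_derivative] refl | simp add: algebra_simps)+
  moreover have "flat_alg (\<lambda>x. (c * r) * flat_exp (k + 2) (r * x + s) + (- c * r * real k) * flat_exp (k + 1) (r * x + s))"
    by (intro flat_alg.intros)
  ultimately show ?case by blast
next
  case (add f g)
  then obtain f' g' where "flat_alg f'" "flat_alg g'"
    "\<And>x. (f has_real_derivative f' x) (at x)" "\<And>x. (g has_real_derivative g' x) (at x)" by blast
  moreover from this have "((\<lambda>x. f x + g x) has_real_derivative f' x + g' x) (at x)" for x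
    by (intro DERIV_add)
  ultimately show ?case
    by (intro exI[of _ "\<lambda>x. f' x + g' x"]) (auto intro!: flat_alg.add)
next
  case (mult f g)
  then obtain f' g' where "flat_alg f'" "flat_alg g'"
    "\<And>x. (f has_real_derivative f' x) (at x)" "\<And>x. (g has_real_derivative g' x) (at x)" by blast
  moreover from this have "((\<lambda>x. f x * g x) has_real_derivative f' x * g x + g' x * f x) (at x)" for x
    by (intro DERIV_mult)
  ultimately show ?case using mult(1,2)
    by (intro exI[of _ "\<lambda>x. f' x * g x + g' x * f x"]) (auto intro!: flat_alg.add flat_alg.mult)
qed

lemma flat_alg_smooth:
  assumes "flat_alg f"
  shows "(deriv ^^ k) f differentiable (at x)"
proof -
  have "flat_alg ((deriv ^^ k) f)"
  proof (induction k)
    case (Suc k)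
    then obtain f' where "flat_alg f'" "\<And>x. ((deriv ^^ k) f has_real_derivative f' x) (at x)"
      using flat_alg_has_derivative by blast
    moreover from this have "deriv ((deriv ^^ k) f) = f'"
      by (auto intro!: DERIV_imp_deriv)
    ultimately show ?case by simp
  qed (use assms in simp)
  then show ?thesis
    using flat_alg_has_derivative real_differentiable_def by blast
qed

text \<open>
  Since \<open>exp (- 1 / (n y))\<close> tends to one for every positive \<open>y\<close>, these functions converge pointwise
  to the indicator of the open interval.
\<close>

definition bump :: "real \<Rightarrow> real \<Rightarrow> nat \<Rightarrow> real \<Rightarrow> real" where
  "bump c d n x = flat_exp 0 (real n * (x - c)) * flat_exp 0 (real n * (d - x))"

lemma flat_exp_0_range: "0 \<le> flat_exp 0 y" "flat_exp 0 y \<le> 1"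
  by (auto simp: flat_exp_def)

lemma bump_range: "0 \<le> bump c d n x" "bump c d n x \<le> 1"
  by (auto simp: bump_def flat_exp_0_range intro!: mult_le_one)

lemma bump_eq_0: "x \<notin> {c<..<d} \<Longrightarrow> bump c d n x = 0"
  by (auto simp: bump_def flat_exp_def zero_less_mult_iff)

lemma test_funI:
  assumes "\<And>k x. (deriv ^^ k) \<phi> differentiable (at x)"
    and "a < c" "d < b" and "\<And>x. x \<notin> {c..d} \<Longrightarrow> \<phi> x = 0"
  shows "test_fun a b \<phi>"
proof -
  have sub: "closure {x. \<phi> x \<noteq> 0} \<subseteq> {c..d}"
  proof (rule closure_minimal)
    show "{x. \<phi> x \<noteq> 0} \<subseteq> {c..d}" using assms(4) by blast
  qed simp
  moreover have "compact (closure {x. \<phi> x \<noteq> 0})"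
    using sub by (meson bounded_closed_interval bounded_subset closed_closure compact_eq_bounded_closed)
  ultimately show ?thesis
    using assms by (auto simp: test_fun_def)
qed

lemma test_fun_bump:
  assumes "a < c" "d < b"
  shows "test_fun a b (bump c d n)"
proof -
  have "flat_alg (\<lambda>x. (1 * flat_exp 0 (real n * x + (- real n * c))) * (1 * flat_exp 0 ((- real n) * x + real n * d)))"
    by (intro flat_alg.intros)
  moreover have "bump c d n = (\<lambda>x. (1 * flat_exp 0 (real n * x + (- real n * c))) * (1 * flat_exp 0 ((- real n) * x + real n * d)))"
    by (auto simp: bump_def algebra_simps)
  ultimately have "flat_alg (bump c d n)" by simp
  then show ?thesis
    using assms by (intro test_funI flat_alg_smooth) (auto intro: bump_eq_0)
qed

lemma bump_tendsto: "(\<lambda>n. bump c d n x) \<longlonglongrightarrow> indicator {c<..<d} x"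
proof (cases "x \<in> {c<..<d}")
  case True
  have 1: "(\<lambda>n. flat_exp 0 (real n * y)) \<longlonglongrightarrow> 1" if "y > 0" for y
  proof -
    have "(\<lambda>n. exp (- (inverse (real n) * inverse y))) \<longlonglongrightarrow> exp (- (0 * inverse y))"
      by (intro tendsto_intros lim_inverse_n)
    then have "(\<lambda>n. exp (- (inverse (real n) * inverse y))) \<longlonglongrightarrow> 1" by simp
    then show ?thesis
      by (rule Lim_transform_eventually)
         (use that in \<open>auto simp: flat_exp_def field_simps eventually_sequentially intro!: exI[of _ 1]\<close>)
  qed
  have "(\<lambda>n. bump c d n x) \<longlonglongrightarrow> 1 * 1"
    unfolding bump_def by (intro tendsto_mult 1) (use True in auto)
  then show ?thesis using True by simp
qed (simp add: bump_eq_0)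

section \<open>The fundamental lemma of the calculus of variations\<close>

lemma integral_leb: "(LINT x|leb a b. f x) = (LINT x:{a..b}|lborel. f x)"
  for f :: "real \<Rightarrow> real"
  unfolding leb_def set_lebesgue_integral_def by (subst integral_restrict_space) auto

lemma integrable_leb: "integrable (leb a b) f \<longleftrightarrow> set_integrable lborel {a..b} f"
  for f :: "real \<Rightarrow> real"
  unfolding leb_def set_integrable_def by (subst integrable_restrict_space) auto

lemma AE_leb: "(AE x in leb a b. P x) \<longleftrightarrow> (AE x in lborel. x \<in> {a..b} \<longrightarrow> P x)"
  unfolding leb_def by (subst AE_restrict_space_iff) auto

text \<open>The interval is, up to its endpoints, a countable union of compact subintervals of its interior.\<close>

lemma AE_leb_if_local:
  assumes "\<And>c d. a < c \<Longrightarrow> c < d \<Longrightarrow> d < b \<Longrightarrow> AE x in lborel. x \<in> {c..d} \<longrightarrow> P x"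
  shows "AE x in leb a b. P x"
proof -
  define c where "c n = a + 1 / real (Suc n)" for n
  define d where "d n = b - 1 / real (Suc n)" for n
  have "AE x in lborel. c n < d n \<longrightarrow> x \<in> {c n..d n} \<longrightarrow> P x" for n
    using assms[of "c n" "d n"] by (cases "c n < d n") (auto simp: c_def d_def)
  then have "AE x in lborel. \<forall>n. c n < d n \<longrightarrow> x \<in> {c n..d n} \<longrightarrow> P x"
    by (simp add: AE_all_countable)
  moreover have "AE x in lborel. x \<noteq> a" "AE x in lborel. x \<noteq> b"
    by (rule AE_lborel_singleton)+
  ultimately show ?thesis
    unfolding AE_leb
  proof eventually_elim
    case (elim x)
    show ?case
    proof
      assume "x \<in> {a..b}"
      then have "0 < min (x - a) (b - x)" using elim by auto
      then obtain n where "inverse (real (Suc n)) < min (x - a) (b - x)"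
        using reals_Archimedean by blast
      then have "c n < x" "x < d n" by (auto simp: c_def d_def inverse_eq_divide)
      then show "P x" using elim(1) by (meson atLeastAtMost_iff less_imp_le less_trans)
    qed
  qed
qed

lemma integrable_mult_AE_bounded:
  fixes f h :: "'a \<Rightarrow> real"
  assumes "integrable M f" "h \<in> borel_measurable M" "AE x in M. \<bar>h x\<bar> \<le> B"
  shows "integrable M (\<lambda>x. f x * h x)"
proof (rule Bochner_Integration.integrable_bound)
  show "integrable M (\<lambda>x. B * f x)" using assms by simp
  show "(\<lambda>x. f x * h x) \<in> borel_measurable M"
    using assms borel_measurable_integrable by (intro borel_measurable_times) auto
  show "AE x in M. norm (f x * h x) \<le> norm (B * f x)"
    using assms(3)
  proof eventually_elim
    case (elim x)
    then have "\<bar>f x\<bar> * \<bar>h x\<bar> \<le> \<bar>f x\<bar> * \<bar>B\<bar>" by (intro mult_left_mono) auto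
    then show ?case by (simp add: abs_mult mult.commute)
  qed
qed

lemma test_fun_has_derivative:
  assumes "test_fun a b \<phi>"
  shows "((deriv ^^ k) \<phi> has_real_derivative (deriv ^^ Suc k) \<phi> x) (at x)"
  using assms by (simp add: test_fun_def DERIV_deriv_iff_real_differentiable)

lemma test_fun_continuous:
  assumes "test_fun a b \<phi>"
  shows "continuous_on A \<phi>" "continuous_on A (deriv \<phi>)"
proof -
  have "continuous_on A ((deriv ^^ k) \<phi>)" for k
    by (rule DERIV_continuous_on)
       (rule has_field_derivative_at_within, rule test_fun_has_derivative[OF assms])
  from this[of 0] this[of 1] show "continuous_on A \<phi>" "continuous_on A (deriv \<phi>)"
    by simp_all
qed

lemma test_fun_support:
  assumes "test_fun a b \<phi>" "a < b"
  obtains c d where "a < c" "c < d" "d < b"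
    "\<And>x. x \<notin> {c..d} \<Longrightarrow> \<phi> x = 0" "\<And>x. x \<notin> {c..d} \<Longrightarrow> deriv \<phi> x = 0"
proof -
  define K where "K = closure {x. \<phi> x \<noteq> 0}"
  have K: "compact K" "K \<subseteq> {a<..<b}" using assms by (auto simp: K_def test_fun_def)
  have "\<exists>c d. a < c \<and> c < d \<and> d < b \<and> K \<subseteq> {c..d}"
  proof (cases "K = {}")
    case True
    then show ?thesis
      using \<open>a < b\<close> by (intro exI[of _ "(2*a+b)/3"] exI[of _ "(a+2*b)/3"]) (auto simp: field_simps)
  next
    case False
    obtain l u where l: "l \<in> K" "\<And>x. x \<in> K \<Longrightarrow> l \<le> x" and u: "u \<in> K" "\<And>x. x \<in> K \<Longrightarrow> x \<le> u"
      using compact_attains_inf[OF K(1) False] compact_attains_sup[OF K(1) False] by metis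
    have "a < l" "l \<le> u" "u < b" using l u K(2) by (auto simp: subset_iff)
    then show ?thesis using l u
      by (intro exI[of _ "(a+l)/2"] exI[of _ "(u+b)/2"]) (auto simp: field_simps; smt (verit))
  qed
  then obtain c d where cd: "a < c" "c < d" "d < b" "K \<subseteq> {c..d}" by blast
  have 0: "\<phi> x = 0" if "x \<notin> {c..d}" for x
    using that cd(4) closure_subset[of "{x. \<phi> x \<noteq> 0}"] by (auto simp: K_def)
  moreover have "deriv \<phi> x = 0" if "x \<notin> {c..d}" for x
  proof -
    have "((\<lambda>_. 0) has_real_derivative 0) (at x)" by simp
    then have "(\<phi> has_real_derivative 0) (at x)"
      by (rule has_field_derivative_transform_within_open[of _ _ _ "- {c..d}"])
         (use that 0 in \<open>auto simp: open_Compl\<close>)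
    then show ?thesis by (rule DERIV_imp_deriv)
  qed
  ultimately show ?thesis using that cd by blast
qed

lemma loc_integrable_mult_compact_support:
  assumes f: "loc_integrable a b f" and h: "continuous_on UNIV h"
    and cd: "a < c" "d < b" "\<And>x. x \<notin> {c..d} \<Longrightarrow> h x = 0"
  shows "integrable (leb a b) (\<lambda>x. f x * h x)"
proof -
  have "integrable lborel (\<lambda>x. indicator {c..d} x * f x)"
    using f cd by (auto simp: loc_integrable_def set_integrable_def)
  moreover have "h \<in> borel_measurable lborel"
    using borel_measurable_continuous_onI[OF h] by simp
  moreover
  have "bounded (h ` {c..d})"
    using h by (intro compact_imp_bounded compact_continuous_image) (auto intro: continuous_on_subset)
  then obtain B where "\<forall>y\<in>h ` {c..d}. norm y \<le> B" using bounded_iff by blast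
  then have B: "\<bar>h x\<bar> \<le> B" if "x \<in> {c..d}" for x using that by simp
  have "\<bar>h x\<bar> \<le> max B 0" for x
    using B[of x] cd(3)[of x] by (cases "x \<in> {c..d}") auto
  ultimately have "integrable lborel (\<lambda>x. (indicator {c..d} x * f x) * h x)"
    by (intro integrable_mult_AE_bounded[where h=h and B="max B 0"]) auto
  moreover have "(\<lambda>x. (indicator {c..d} x * f x) * h x) = (\<lambda>x. indicator {a..b} x *\<^sub>R (f x * h x))"
  proof
    fix x
    show "(indicator {c..d} x * f x) * h x = indicator {a..b} x *\<^sub>R (f x * h x)"
      using cd by (cases "x \<in> {c..d}") auto
  qed
  ultimately show ?thesis
    by (simp add: integrable_leb set_integrable_def)
qed

text \<open>The passage from test functions to intervals: all bumps are dominated by the indicator of one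
  compact interval, on which \<open>f\<close> is integrable.\<close>

lemma integral_mult_bump_tendsto:
  assumes f: "loc_integrable a b f" and cd: "a < c" "d < b"
  shows "(\<lambda>n. LINT x|leb a b. f x * bump c d n x) \<longlonglongrightarrow> (LINT x:{c<..<d}|lborel. f x)"
proof -
  have f': "integrable lborel (\<lambda>x. indicator {c..d} x * f x)"
    using f cd by (auto simp: loc_integrable_def set_integrable_def)
  have [measurable]: "bump c d n \<in> borel_measurable borel" for n
    using test_fun_continuous(1)[OF test_fun_bump[OF cd]] by (intro borel_measurable_continuous_onI)
  have "(\<lambda>n. LINT x|lborel. (indicator {c..d} x * f x) * bump c d n x) \<longlonglongrightarrow>
      (LINT x|lborel. (indicator {c..d} x * f x) * indicator {c<..<d} x)"
  proof (rule integral_dominated_convergence[where w="\<lambda>x. norm (indicator {c..d} x * f x)"])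
    show "AE x in lborel. (\<lambda>n. (indicator {c..d} x * f x) * bump c d n x)
        \<longlonglongrightarrow> (indicator {c..d} x * f x) * indicator {c<..<d} x"
      by (intro AE_I2 tendsto_mult tendsto_const bump_tendsto)
    show "AE x in lborel. norm (indicator {c..d} x * f x * bump c d n x) \<le> norm (indicator {c..d} x * f x)" for n
    proof (rule AE_I2)
      fix x
      show "norm (indicator {c..d} x * f x * bump c d n x) \<le> norm (indicator {c..d} x * f x)"
        using bump_range[of c d n x] mult_left_mono[of "bump c d n x" 1 "norm (indicator {c..d} x * f x)"]
        by (simp add: norm_mult abs_mult)
    qed
  qed (use f' borel_measurable_integrable[OF f'] in auto)
  moreover have "(LINT x|lborel. (indicator {c..d} x * f x) * bump c d n x) = (LINT x|leb a b. f x * bump c d n x)" for n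
    unfolding integral_leb set_lebesgue_integral_def
  proof (intro Bochner_Integration.integral_cong refl)
    fix x
    show "indicator {c..d} x * f x * bump c d n x = indicator {a..b} x *\<^sub>R (f x * bump c d n x)"
      using cd bump_eq_0[of x c d n] by (cases "x \<in> {c<..<d}") auto
  qed
  moreover have "(LINT x|lborel. (indicator {c..d} x * f x) * indicator {c<..<d} x) = (LINT x:{c<..<d}|lborel. f x)"
    unfolding set_lebesgue_integral_def
    by (intro Bochner_Integration.integral_cong) (auto simp: indicator_def)
  ultimately show ?thesis by simp
qed

text \<open>After multiplication by the indicator of \<open>{c..d}\<close>, the integral over any interval is an integral
  over a subinterval of \<open>{c..d}\<close>, up to endpoints, which have measure zero.\<close>

lemma AE_nonneg_if_local_interval_integrals_nonneg:
  assumes u: "loc_integrable a b u"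
    and nonneg: "\<And>c d. a < c \<Longrightarrow> c < d \<Longrightarrow> d < b \<Longrightarrow> 0 \<le> (LINT x:{c<..<d}|lborel. u x)"
  shows "AE x in leb a b. 0 \<le> u x"
proof (rule AE_leb_if_local)
  fix c d :: real assume cd: "a < c" "c < d" "d < b"
  have v: "integrable lborel (\<lambda>x. indicator {c..d} x * u x)"
    using u cd by (auto simp: loc_integrable_def set_integrable_def)
  have "AE x in lborel. 0 \<le> indicator {c..d} x * u x"
  proof (rule AE_nonneg_if_interval_integrals_nonneg[OF v])
    fix x y :: real assume "x < y"
    define l where "l = max x c"
    define r where "r = min y d"
    have "(LINT t:{x<..y}|lborel. indicator {c..d} t * u t) = (LINT t:{l<..<r}|lborel. u t)"
      unfolding set_lebesgue_integral_def
    proof (rule integral_cong_AE)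
      show "AE t in lborel. indicat_real {x<..y} t *\<^sub>R (indicat_real {c..d} t * u t) = indicat_real {l<..<r} t *\<^sub>R u t"
        using AE_lborel_singleton[of l] AE_lborel_singleton[of r]
        by eventually_elim (auto simp: l_def r_def indicator_def split: if_splits)
      show "(\<lambda>t. indicat_real {x<..y} t *\<^sub>R (indicat_real {c..d} t * u t)) \<in> borel_measurable lborel"
        using borel_measurable_integrable[OF v] by measurable
      have "(\<lambda>t. indicat_real {l<..<r} t *\<^sub>R (indicat_real {c..d} t * u t)) \<in> borel_measurable lborel"
        using borel_measurable_integrable[OF v] by measurable
      also have "(\<lambda>t. indicat_real {l<..<r} t *\<^sub>R (indicat_real {c..d} t * u t)) = (\<lambda>t. indicat_real {l<..<r} t *\<^sub>R u t)"
        by (auto simp: l_def r_def indicator_def)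
      finally show "(\<lambda>t. indicat_real {l<..<r} t *\<^sub>R u t) \<in> borel_measurable lborel" .
    qed
    moreover have "0 \<le> (LINT t:{l<..<r}|lborel. u t)"
    proof (cases "l < r")
      case True
      then show ?thesis using cd by (intro nonneg) (auto simp: l_def r_def)
    qed (simp add: set_lebesgue_integral_def)
    ultimately show "0 \<le> (LINT t:{x<..y}|lborel. indicator {c..d} t * u t)" by simp
  qed
  then show "AE x in lborel. x \<in> {c..d} \<longrightarrow> 0 \<le> u x"
    by eventually_elim auto
qed

lemma loc_integrable_lincomb:
  assumes "loc_integrable a b f" "loc_integrable a b g"
  shows "loc_integrable a b (\<lambda>x. f x - r * g x)"
  using assms unfolding loc_integrable_def by (auto intro!: set_integral_diff(1))

lemma loc_integrable_const: "loc_integrable a b (\<lambda>_. k)"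
  unfolding loc_integrable_def by (auto intro!: borel_integrable_atLeastAtMost')

lemma fundamental_lemma:
  assumes u: "loc_integrable a b u"
    and 0: "\<And>\<phi>. test_fun a b \<phi> \<Longrightarrow> (LINT x|leb a b. u x * \<phi> x) = 0"
  shows "AE x in leb a b. u x = 0"
proof -
  have zero: "(LINT x:{c<..<d}|lborel. u x) = 0" if "a < c" "d < b" for c d
    using integral_mult_bump_tendsto[OF u that] 0[OF test_fun_bump[OF that]] by (simp add: LIMSEQ_const_iff)
  have "loc_integrable a b (\<lambda>x. 0 - 1 * u x)"
    by (intro loc_integrable_lincomb loc_integrable_const u)
  then have "AE x in leb a b. 0 \<le> - u x"
    using zero by (intro AE_nonneg_if_local_interval_integrals_nonneg) (simp_all add: set_lebesgue_integral_def)
  moreover have "AE x in leb a b. 0 \<le> u x"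
    using zero u by (intro AE_nonneg_if_local_interval_integrals_nonneg) simp_all
  ultimately show ?thesis by eventually_elim auto
qed

lemma test_fun_lincomb:
  assumes f: "test_fun a b f" and g: "test_fun a b g" and "a < b"
  shows "test_fun a b (\<lambda>x. f x - r * g x)"
proof -
  have D: "((\<lambda>x. (deriv ^^ k) f x - r * (deriv ^^ k) g x) has_real_derivative
      (deriv ^^ Suc k) f x - r * (deriv ^^ Suc k) g x) (at x)" for k x
    by (intro DERIV_diff DERIV_cmult test_fun_has_derivative[OF f] test_fun_has_derivative[OF g])
  have "(deriv ^^ k) (\<lambda>x. f x - r * g x) = (\<lambda>x. (deriv ^^ k) f x - r * (deriv ^^ k) g x)" for k
  proof (induction k)
    case (Suc k)
    show ?case
      using D[of k] by (auto simp: Suc fun_eq_iff intro!: DERIV_imp_deriv)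
  qed simp
  then have smooth: "(deriv ^^ k) (\<lambda>x. f x - r * g x) differentiable (at x)" for k x
    using D real_differentiable_def by metis
  obtain c d where cd: "a < c" "c < d" "d < b" "\<And>x. x \<notin> {c..d} \<Longrightarrow> f x = 0"
    using test_fun_support[OF f \<open>a < b\<close>] by metis
  obtain c' d' where cd': "a < c'" "c' < d'" "d' < b" "\<And>x. x \<notin> {c'..d'} \<Longrightarrow> g x = 0"
    using test_fun_support[OF g \<open>a < b\<close>] by metis
  show ?thesis
  proof (rule test_funI[OF smooth])
    show "a < min c c'" "max d d' < b" using cd cd' by auto
    show "f x - r * g x = 0" if "x \<notin> {min c c'..max d d'}" for x
    proof -
      have "x \<notin> {c..d}" "x \<notin> {c'..d'}" using that by auto
      then show ?thesis using cd(4) cd'(4) by simp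
    qed
  qed
qed

text \<open>The primitive starting at \<open>a\<close> vanishes to the left of the support. Because the mean is zero it
  also vanishes to the right of it, so it has compact support again.\<close>

lemma test_fun_antiderivative:
  assumes \<theta>: "test_fun a b \<theta>" and "a < b" and 0: "(LINT x|leb a b. \<theta> x) = 0"
  obtains \<phi> where "test_fun a b \<phi>" "deriv \<phi> = \<theta>"
proof -
  obtain c d where cd: "a < c" "c < d" "d < b" "\<And>x. x \<notin> {c..d} \<Longrightarrow> \<theta> x = 0"
    using test_fun_support[OF \<theta> \<open>a < b\<close>] by metis
  define \<phi> where "\<phi> x = integral {a..x} \<theta>" for x
  have cont: "continuous_on A \<theta>" for A using test_fun_continuous[OF \<theta>] by blast
  have int: "\<theta> integrable_on {x..y}" for x y by (intro integrable_continuous_real cont)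
  have left: "\<phi> x = 0" if "x < c" for x
    unfolding \<phi>_def by (rule integral_unique[OF has_integral_is_0]) (use cd that in auto)
  have "integral {a..b} \<theta> = 0"
    using 0 set_borel_integral_eq_integral(2)[OF borel_integrable_atLeastAtMost'[OF cont]]
    by (simp add: integral_leb)
  have right: "\<phi> x = 0" if "x > d" for x
  proof -
    have "integral {a..max x b} \<theta> = integral {a..x} \<theta> + integral {x..max x b} \<theta>"
      by (rule Henstock_Kurzweil_Integration.integral_combine[symmetric]) (use that cd int in auto)
    moreover have "integral {a..max x b} \<theta> = integral {a..b} \<theta> + integral {b..max x b} \<theta>"
      by (rule Henstock_Kurzweil_Integration.integral_combine[symmetric]) (use that cd int in auto)
    moreover have "integral {x..max x b} \<theta> = 0" "integral {b..max x b} \<theta> = 0"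
      by (rule integral_unique[OF has_integral_is_0]; use cd that in auto)+
    ultimately show ?thesis using \<open>integral {a..b} \<theta> = 0\<close> by (simp add: \<phi>_def)
  qed
  have D: "(\<phi> has_real_derivative \<theta> x) (at x)" for x
  proof (cases "x < c \<or> d < x")
    case True
    have "((\<lambda>_. 0) has_real_derivative 0) (at x)" by simp
    then have "(\<phi> has_real_derivative 0) (at x)"
      by (rule has_field_derivative_transform_within_open[of _ _ _ "- {c..d}"])
         (use True left right in \<open>auto simp: open_Compl\<close>)
    then show ?thesis using True cd by auto
  next
    case False
    then have "x \<in> interior {a..b}" using cd by auto
    moreover have "((\<lambda>x. integral {a..x} \<theta>) has_real_derivative \<theta> x) (at x within {a..b})"
      by (rule integral_has_real_derivative[OF cont]) (use False cd in auto)
    moreover have "\<phi> = (\<lambda>x. integral {a..x} \<theta>)" by (intro ext) (simp only: \<phi>_def)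
    ultimately show ?thesis by (simp only: at_within_interior)
  qed
  then have deriv: "deriv \<phi> = \<theta>" by (intro ext DERIV_imp_deriv)
  have smooth: "(deriv ^^ k) \<phi> differentiable (at x)" for k x
  proof (cases k)
    case 0
    then show ?thesis using D real_differentiable_def by auto
  next
    case (Suc j)
    have "(deriv ^^ Suc j) \<phi> = (deriv ^^ j) \<theta>"
      by (simp only: funpow_Suc_right o_apply deriv)
    moreover have "(deriv ^^ j) \<theta> differentiable (at x)"
      using \<theta> unfolding test_fun_def by blast
    ultimately show ?thesis using Suc by (simp only:)
  qed
  have "test_fun a b \<phi>"
    by (rule test_funI[OF smooth cd(1,3)]) (use left right in force)
  then show ?thesis using that deriv by blast
qed

text \<open>Subtracting from a test function \<open>\<psi>\<close> a suitable multiple of one fixed test function \<open>\<eta>\<close> with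
  nonzero integral leaves a function of mean zero, which is the derivative of a test function. Hence
  the integral of \<open>f \<psi>\<close> is a fixed multiple \<open>k\<close> of the integral of \<open>\<psi>\<close>, and the fundamental lemma
  applies to \<open>f - k\<close>.\<close>

lemma du_bois_reymond:
  assumes f: "loc_integrable a b f" and "a < b"
    and 0: "\<And>\<phi>. test_fun a b \<phi> \<Longrightarrow> (LINT x|leb a b. f x * deriv \<phi> x) = 0"
  shows "\<exists>k. AE x in leb a b. f x = k"
proof -
  define c d where "c = (2*a+b)/3" and "d = (a+2*b)/3"
  have cd: "a < c" "c < d" "d < b" using \<open>a < b\<close> by (auto simp: c_def d_def field_simps)
  have "(\<lambda>n. LINT x|leb a b. 1 * bump c d n x) \<longlonglongrightarrow> (LINT x:{c<..<d}|lborel. 1)"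
    by (intro integral_mult_bump_tendsto loc_integrable_const cd)
  moreover have "(LINT x:{c<..<d}|lborel. (1::real)) \<noteq> 0"
    using cd by (simp add: set_lebesgue_integral_def)
  ultimately have "eventually (\<lambda>n. (LINT x|leb a b. 1 * bump c d n x) \<noteq> 0) sequentially"
    by (rule tendsto_imp_eventually_ne)
  then obtain n where n: "(LINT x|leb a b. bump c d n x) \<noteq> 0"
    by (auto simp: eventually_sequentially)
  \<comment> \<open>The integrals of the bumps tend to \<open>d - c\<close>, so one of them is nonzero.\<close>
  define \<eta> where "\<eta> = bump c d n"
  define J where "J = (LINT x|leb a b. \<eta> x)"
  define k where "k = (LINT x|leb a b. f x * \<eta> x) / J"
  have \<eta>: "test_fun a b \<eta>" and J: "J \<noteq> 0" using cd n test_fun_bump by (auto simp: \<eta>_def J_def)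
  have int: "integrable (leb a b) (\<lambda>x. g x * \<phi> x)" if "test_fun a b \<phi>" "loc_integrable a b g" for \<phi> g
    using test_fun_support[OF that(1) \<open>a < b\<close>] test_fun_continuous[OF that(1)] that(2)
      loc_integrable_mult_compact_support by metis
  have "AE x in leb a b. f x - k * 1 = 0"
  proof (rule fundamental_lemma)
    show "loc_integrable a b (\<lambda>x. f x - k * 1)"
      by (intro loc_integrable_lincomb f loc_integrable_const)
    fix \<psi> assume \<psi>: "test_fun a b \<psi>"
    define r where "r = (LINT x|leb a b. \<psi> x) / J"
    note i = int[OF \<psi> f] int[OF \<eta> f] int[OF \<psi> loc_integrable_const[of _ _ 1], simplified]
      int[OF \<eta> loc_integrable_const[of _ _ 1], simplified]
    have \<theta>: "test_fun a b (\<lambda>x. \<psi> x - r * \<eta> x)"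
      by (intro test_fun_lincomb \<psi> \<eta> \<open>a < b\<close>)
    have "(LINT x|leb a b. \<psi> x - r * \<eta> x) = 0"
      using i J by (simp add: r_def J_def)
    then obtain \<phi> where "test_fun a b \<phi>" "deriv \<phi> = (\<lambda>x. \<psi> x - r * \<eta> x)"
      using test_fun_antiderivative[OF \<theta> \<open>a < b\<close>] by blast
    then have "(LINT x|leb a b. f x * (\<psi> x - r * \<eta> x)) = 0"
      using 0[of \<phi>] by simp
    moreover have "(LINT x|leb a b. f x * (\<psi> x - r * \<eta> x))
        = (LINT x|leb a b. f x * \<psi> x - r * (f x * \<eta> x))"
      by (simp add: algebra_simps)
    ultimately have "(LINT x|leb a b. f x * \<psi> x) = k * (LINT x|leb a b. \<psi> x)"
      using i by (simp add: k_def r_def)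
    moreover have "(LINT x|leb a b. (f x - k * 1) * \<psi> x) = (LINT x|leb a b. f x * \<psi> x - k * \<psi> x)"
      by (simp add: algebra_simps)
    ultimately show "(LINT x|leb a b. (f x - k * 1) * \<psi> x) = 0"
      using i by simp
  qed
  then show ?thesis by auto
qed

section \<open>Primitives of integrable functions\<close>

text \<open>
  Integration starts at minus infinity, so that a function on \<open>{a..b}\<close> extended by zero has the
  primitive starting at \<open>a\<close>, and derivatives of test functions are covered by the same definition.
\<close>

definition primitive :: "(real \<Rightarrow> real) \<Rightarrow> real \<Rightarrow> real" where
  "primitive u x = (LINT t:{..x}|lborel. u t)"

lemma primitive_diff:
  assumes u: "integrable lborel u" and "x \<le> y"
  shows "primitive u y - primitive u x = (LINT t:{x<..<y}|lborel. u t)"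
proof -
  have [measurable]: "u \<in> borel_measurable borel" using borel_measurable_integrable[OF u] by simp
  have "primitive u y - primitive u x = (LINT t|lborel. indicator {..y} t *\<^sub>R u t - indicator {..x} t *\<^sub>R u t)"
    unfolding primitive_def set_lebesgue_integral_def
    by (rule Bochner_Integration.integral_diff[symmetric]) (intro integrable_mult_indicator u; simp)+
  also have "\<dots> = (LINT t:{x<..<y}|lborel. u t)"
    unfolding set_lebesgue_integral_def
  proof (rule integral_cong_AE)
    show "AE t in lborel. indicator {..y} t *\<^sub>R u t - indicator {..x} t *\<^sub>R u t = indicator {x<..<y} t *\<^sub>R u t"
      using AE_lborel_singleton[of x] AE_lborel_singleton[of y]
      by eventually_elim (use \<open>x \<le> y\<close> in \<open>auto simp: indicator_def\<close>)
  qed measurable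
  finally show ?thesis .
qed

lemma primitive_bounded:
  assumes u: "integrable lborel u"
  shows "\<bar>primitive u x\<bar> \<le> (LINT t|lborel. \<bar>u t\<bar>)"
proof -
  have "\<bar>primitive u x\<bar> \<le> (LINT t|lborel. \<bar>indicator {..x} t *\<^sub>R u t\<bar>)"
    unfolding primitive_def set_lebesgue_integral_def by (rule integral_abs_bound)
  also have "\<dots> \<le> (LINT t|lborel. \<bar>u t\<bar>)"
  proof (rule integral_mono)
    show "integrable lborel (\<lambda>t. \<bar>indicator {..x} t *\<^sub>R u t\<bar>)"
      by (intro integrable_abs integrable_mult_indicator u) simp
  qed (use u in \<open>auto simp: indicator_def\<close>)
  finally show ?thesis .
qed

lemma primitive_continuous:
  assumes u: "integrable lborel u"
  shows "continuous_on A (primitive u)"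
proof -
  have [measurable]: "u \<in> borel_measurable borel" using borel_measurable_integrable[OF u] by simp
  have "isCont (primitive u) x" for x
    unfolding continuous_at_sequentially o_def
  proof safe
    fix s :: "nat \<Rightarrow> real" assume s: "s \<longlonglongrightarrow> x"
    show "(\<lambda>n. primitive u (s n)) \<longlonglongrightarrow> primitive u x"
      unfolding primitive_def set_lebesgue_integral_def
    proof (rule integral_dominated_convergence[where w="\<lambda>t. \<bar>u t\<bar>"])
      show "AE t in lborel. (\<lambda>n. indicator {..s n} t *\<^sub>R u t) \<longlonglongrightarrow> indicator {..x} t *\<^sub>R u t"
        using AE_lborel_singleton[of x]
      proof eventually_elim
        case (elim t)
        have "eventually (\<lambda>n. indicator {..x} t *\<^sub>R u t = indicator {..s n} t *\<^sub>R u t) sequentially"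
        proof (cases "t < x")
          case True
          from order_tendstoD(1)[OF s True] show ?thesis
            by eventually_elim (use True in auto)
        next
          case False
          then have "x < t" using elim by auto
          from order_tendstoD(2)[OF s this] show ?thesis
            by eventually_elim (use \<open>x < t\<close> in auto)
        qed
        then show ?case by (rule Lim_transform_eventually[OF tendsto_const])
      qed
    qed (use u in \<open>auto simp: indicator_def\<close>)
  qed
  then show ?thesis by (simp add: continuous_at_imp_continuous_on)
qed

lemma primitive_measurable [measurable]:
  "integrable lborel u \<Longrightarrow> primitive u \<in> borel_measurable borel"
  by (intro borel_measurable_continuous_onI primitive_continuous)

text \<open>Fubini's theorem: the integral of \<open>u s * v t\<close> over the plane is split along the diagonal into the
  part where \<open>t \<le> s\<close> and the part where \<open>s < t\<close>.\<close>

lemma integral_mult_eq_integral_primitive: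
  assumes u: "integrable lborel u" and v: "integrable lborel v"
  shows "(LINT t|lborel. u t) * (LINT t|lborel. v t)
    = (LINT t|lborel. u t * primitive v t) + (LINT t|lborel. primitive u t * v t)"
proof -
  have [measurable]: "u \<in> borel_measurable borel" "v \<in> borel_measurable borel"
    using borel_measurable_integrable[OF u] borel_measurable_integrable[OF v] by simp_all
  define B where "B s = (LINT t:{s<..}|lborel. v t)" for s
  have split: "(LINT t|lborel. v t) = primitive v s + B s" for s
  proof -
    have "primitive v s + B s = (LINT t|lborel. indicator {..s} t *\<^sub>R v t + indicator {s<..} t *\<^sub>R v t)"
      unfolding primitive_def B_def set_lebesgue_integral_def
      by (rule Bochner_Integration.integral_add[symmetric]) (intro integrable_mult_indicator v; simp)+
    also have "\<dots> = (LINT t|lborel. v t)"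
      by (rule Bochner_Integration.integral_cong) (auto simp: indicator_def)
    finally show ?thesis by simp
  qed
  have int1: "integrable lborel (\<lambda>s. u s * primitive v s)"
    using primitive_bounded[OF v] v by (intro integrable_mult_AE_bounded[OF u] AE_I2) auto
  have "integrable lborel (\<lambda>s. u s * (LINT t|lborel. v t) - u s * primitive v s)"
    using u int1 by simp
  moreover have "u s * (LINT t|lborel. v t) - u s * primitive v s = u s * B s" for s
    by (simp add: split[of s] algebra_simps)
  ultimately have int2: "integrable lborel (\<lambda>s. u s * B s)" by simp
  have "(LINT t|lborel. u t) * (LINT t|lborel. v t) = (LINT s|lborel. u s * (LINT t|lborel. v t))"
    by simp
  also have "\<dots> = (LINT s|lborel. u s * primitive v s + u s * B s)"
  proof (intro Bochner_Integration.integral_cong refl)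
    fix s show "u s * (LINT t|lborel. v t) = u s * primitive v s + u s * B s"
      unfolding split[of s] by (rule distrib_left)
  qed
  also have "\<dots> = (LINT s|lborel. u s * primitive v s) + (LINT s|lborel. u s * B s)"
    by (intro Bochner_Integration.integral_add int1 int2)
  also have "(LINT s|lborel. u s * B s) = (LINT s|lborel. LINT t|lborel. indicator {s<..} t * (u s * v t))"
    unfolding B_def set_lebesgue_integral_def
    by (intro Bochner_Integration.integral_cong refl) (simp add: mult_ac flip: integral_mult_right_zero)
  also have "\<dots> = (LINT t|lborel. LINT s|lborel. indicator {s<..} t * (u s * v t))"
  proof (rule lborel_pair.Fubini_integral[symmetric])
    have uv: "integrable (lborel \<Otimes>\<^sub>M lborel) (\<lambda>(s, t). u s * v t)"
    proof (rule lborel_pair.Fubini_integrable)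
      show "integrable lborel (\<lambda>x. LBINT y. norm (case (x, y) of (s, t) \<Rightarrow> u s * v t))"
        using u by (simp add: abs_mult)
      show "AE x in lborel. integrable lborel (\<lambda>y. case (x, y) of (s, t) \<Rightarrow> u s * v t)"
        using v by simp
    qed measurable
    show "integrable (lborel \<Otimes>\<^sub>M lborel) (\<lambda>(s, t). indicator {s<..} t * (u s * v t))"
    proof (rule Bochner_Integration.integrable_bound[OF uv])
      have "(\<lambda>(s, t). indicator {(s,t). s < t} (s, t) * (u s * v t)) \<in> borel_measurable (lborel \<Otimes>\<^sub>M (lborel :: real measure))"
        by measurable
      also have "(\<lambda>(s, t). indicator {(s,t). s < t} (s, t) * (u s * v t)) = (\<lambda>(s, t). indicator {s<..} t * (u s * v t))"
        by (auto simp: indicator_def)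
      finally show "(\<lambda>(s, t). indicator {s<..} t * (u s * v t)) \<in> borel_measurable (lborel \<Otimes>\<^sub>M lborel)" .
    qed (auto simp: indicator_def)
  qed
  also have "\<dots> = (LINT t|lborel. primitive u t * v t)"
  proof (intro Bochner_Integration.integral_cong refl)
    fix t
    have "(LINT s|lborel. indicator {s<..} t * (u s * v t)) = (LINT s|lborel. (indicator {..t} s *\<^sub>R u s) * v t)"
    proof (rule integral_cong_AE)
      show "AE s in lborel. indicator {s<..} t * (u s * v t) = (indicator {..t} s *\<^sub>R u s) * v t"
        using AE_lborel_singleton[of t] by eventually_elim (auto simp: indicator_def)
      have "(\<lambda>s. indicator {..<t} s * (u s * v t)) \<in> borel_measurable lborel" by measurable
      also have "(\<lambda>s. indicator {..<t} s * (u s * v t)) = (\<lambda>s. indicator {s<..} t * (u s * v t))"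
        by (auto simp: indicator_def)
      finally show "(\<lambda>s. indicator {s<..} t * (u s * v t)) \<in> borel_measurable lborel" .
    qed measurable
    then show "(LINT s|lborel. indicator {s<..} t * (u s * v t)) = primitive u t * v t"
      by (simp add: primitive_def set_lebesgue_integral_def)
  qed
  finally show ?thesis .
qed

lemma primitive_cutoff: "s \<le> x \<Longrightarrow> primitive (\<lambda>t. indicator {..x} t * u t) s = primitive u s"
  unfolding primitive_def set_lebesgue_integral_def
  by (intro Bochner_Integration.integral_cong) (auto simp: indicator_def)

text \<open>The product rule for absolutely continuous functions in integrated form, obtained by cutting both
  integrands off at \<open>x\<close>.\<close>

lemma primitive_mult:
  assumes u: "integrable lborel u" and v: "integrable lborel v"
  shows "primitive u x * primitive v x = primitive (\<lambda>t. u t * primitive v t + primitive u t * v t) x"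
proof -
  have cut: "integrable lborel (\<lambda>t. indicator {..x} t * f t)" if "integrable lborel f" for f :: "real \<Rightarrow> real"
    using integrable_mult_indicator[OF _ that, of "{..x}"] by simp
  have [measurable]: "u \<in> borel_measurable borel" "v \<in> borel_measurable borel"
    using borel_measurable_integrable[OF u] borel_measurable_integrable[OF v] by simp_all
  have int: "integrable lborel (\<lambda>s. u s * primitive v s)" "integrable lborel (\<lambda>s. v s * primitive u s)"
    using primitive_bounded[OF v] primitive_bounded[OF u] u v
    by (intro integrable_mult_AE_bounded AE_I2; auto)+
  have "primitive u x * primitive v x
      = (LINT t|lborel. indicator {..x} t * u t) * (LINT t|lborel. indicator {..x} t * v t)"
    by (simp add: primitive_def set_lebesgue_integral_def)
  also have "\<dots> = (LINT t|lborel. (indicator {..x} t * u t) * primitive (\<lambda>t. indicator {..x} t * v t) t)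
      + (LINT t|lborel. primitive (\<lambda>t. indicator {..x} t * u t) t * (indicator {..x} t * v t))"
    by (intro integral_mult_eq_integral_primitive cut u v)
  also have "\<dots> = (LINT t|lborel. indicator {..x} t * (u t * primitive v t))
      + (LINT t|lborel. indicator {..x} t * (v t * primitive u t))"
  proof (intro arg_cong2[where f="(+)"] Bochner_Integration.integral_cong refl)
    fix t
    show "indicator {..x} t * u t * primitive (\<lambda>t. indicator {..x} t * v t) t = indicator {..x} t * (u t * primitive v t)"
      "primitive (\<lambda>t. indicator {..x} t * u t) t * (indicator {..x} t * v t) = indicator {..x} t * (v t * primitive u t)"
      by (cases "t \<le> x"; simp add: primitive_cutoff)+
  qed
  also have "\<dots> = (LINT t|lborel. indicator {..x} t * (u t * primitive v t) + indicator {..x} t * (v t * primitive u t))"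
    by (intro Bochner_Integration.integral_add[symmetric] cut int)
  also have "\<dots> = primitive (\<lambda>t. u t * primitive v t + primitive u t * v t) x"
    by (simp add: primitive_def set_lebesgue_integral_def algebra_simps)
  finally show ?thesis .
qed

lemma primitive_deriv_test_fun:
  assumes \<phi>: "test_fun a b \<phi>" and "a < b"
  shows "integrable lborel (deriv \<phi>)" "primitive (deriv \<phi>) x = \<phi> x"
proof -
  obtain c d where cd: "a < c" "c < d" "d < b"
    "\<And>x. x \<notin> {c..d} \<Longrightarrow> \<phi> x = 0" "\<And>x. x \<notin> {c..d} \<Longrightarrow> deriv \<phi> x = 0"
    using test_fun_support[OF \<phi> \<open>a < b\<close>] by metis
  have cont: "continuous_on A (deriv \<phi>)" for A using test_fun_continuous[OF \<phi>] by blast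
  have "integrable lborel (\<lambda>x. indicator {c..d} x *\<^sub>R deriv \<phi> x)"
    using borel_integrable_atLeastAtMost'[OF cont] by (simp add: set_integrable_def)
  also have "(\<lambda>x. indicator {c..d} x *\<^sub>R deriv \<phi> x) = deriv \<phi>"
  proof
    fix x show "indicator {c..d} x *\<^sub>R deriv \<phi> x = deriv \<phi> x"
      using cd(5)[of x] by (cases "x \<in> {c..d}") auto
  qed
  finally show "integrable lborel (deriv \<phi>)" .
  define l where "l = min c x - 1"
  have "primitive (deriv \<phi>) x = (LINT t|lborel. indicator {l..x} t *\<^sub>R deriv \<phi> t)"
    unfolding primitive_def set_lebesgue_integral_def
  proof (intro Bochner_Integration.integral_cong refl)
    fix t show "indicator {..x} t *\<^sub>R deriv \<phi> t = indicator {l..x} t *\<^sub>R deriv \<phi> t"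
    proof (cases "l \<le> t")
      case False
      then have "t \<notin> {c..d}" by (auto simp: l_def)
      then show ?thesis using cd(5) by simp
    qed (simp add: indicator_def)
  qed
  also have "\<dots> = \<phi> x - \<phi> l"
    using test_fun_has_derivative[OF \<phi>, of 0]
    by (intro integral_FTC_atLeastAtMost cont)
       (auto simp: l_def has_real_derivative_iff_has_vector_derivative[symmetric] intro: has_field_derivative_at_within)
  also have "\<phi> l = 0" using cd by (auto simp: l_def)
  finally show "primitive (deriv \<phi>) x = \<phi> x" by simp
qed

section \<open>Weak derivatives\<close>

text \<open>Local integrability concerns the open interval only. Changing a function at the two endpoints
  preserves Borel measurability, so its values there are harmless.\<close>

lemma loc_integrable_measurable:
  assumes f: "loc_integrable a b f" and "a < b"
  shows "f \<in> borel_measurable (leb a b)"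
proof -
  define c where "c n = a + 1 / real (Suc n)" for n
  define d where "d n = b - 1 / real (Suc n)" for n
  define F where "F n x = indicator {c n..d n} x *\<^sub>R f x + indicator {a} x * f a + indicator {b} x * f b" for n x
  have [measurable]: "(\<lambda>x. indicator {c n..d n} x *\<^sub>R f x) \<in> borel_measurable borel" for n
    using f borel_measurable_integrable[of lborel "\<lambda>x. indicator {c n..d n} x *\<^sub>R f x"]
    by (simp add: loc_integrable_def set_integrable_def c_def d_def)
  have "(\<lambda>x. indicator {a..b} x *\<^sub>R f x) \<in> borel_measurable borel"
  proof (rule borel_measurable_LIMSEQ_real[where u=F])
    show "F n \<in> borel_measurable borel" for n unfolding F_def by measurable
    fix x :: real
    have c: "c \<longlonglongrightarrow> a + 0" and d: "d \<longlonglongrightarrow> b - 0"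
      unfolding c_def d_def by (intro tendsto_intros LIMSEQ_Suc[OF lim_1_over_n])+
    show "(\<lambda>n. F n x) \<longlonglongrightarrow> indicator {a..b} x *\<^sub>R f x"
    proof (cases "x \<in> {a<..<b}")
      case True
      have "eventually (\<lambda>n. c n < x) sequentially" "eventually (\<lambda>n. x < d n) sequentially"
        using order_tendstoD(2)[OF c, of x] order_tendstoD(1)[OF d, of x] True by auto
      then have "eventually (\<lambda>n. indicator {a..b} x *\<^sub>R f x = F n x) sequentially"
        by eventually_elim (use True in \<open>auto simp: F_def indicator_def\<close>)
      then show ?thesis by (rule Lim_transform_eventually[OF tendsto_const])
    next
      case False
      have "F n x = indicator {a..b} x *\<^sub>R f x" for n
      proof -
        have "a < c n" "d n < b" by (auto simp: c_def d_def)
        then show ?thesis using False \<open>a < b\<close> by (auto simp: F_def indicator_def)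
      qed
      then show ?thesis by simp
    qed
  qed
  then show ?thesis
    unfolding leb_def by (subst borel_measurable_restrict_space_iff) auto
qed

lemma borel_measurable_leb: "borel_measurable (leb a b) = borel_measurable (restrict_space borel {a..b})"
  by (rule measurable_cong_sets) (auto simp: leb_def sets_restrict_space)

text \<open>The product rule \<open>primitive_mult\<close> with the test function as second factor is evaluated at \<open>b\<close>,
  where the test function vanishes. This is integration by parts.\<close>

lemma weak_deriv_primitive:
  assumes g: "integrable (leb a b) g" and "a < b"
  shows "has_weak_deriv a b (\<lambda>x. k + primitive (\<lambda>t. indicator {a..b} t * g t) x) g"
proof -
  define u where "u = (\<lambda>t. indicator {a..b} t * g t)"
  have u: "integrable lborel u"
    using g by (simp add: integrable_leb set_integrable_def u_def)
  have g_loc: "loc_integrable a b g"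
    using g unfolding integrable_leb loc_integrable_def by (auto intro: set_integrable_subset)
  have P_loc: "loc_integrable a b (primitive u)"
    unfolding loc_integrable_def
    by (auto intro!: borel_integrable_atLeastAtMost' primitive_continuous u)
  have "(LINT x|leb a b. (k + primitive u x) * deriv \<phi> x) = - (LINT x|leb a b. g x * \<phi> x)"
    if \<phi>: "test_fun a b \<phi>" for \<phi>
  proof -
    obtain c d where cd: "a < c" "c < d" "d < b"
      "\<And>x. x \<notin> {c..d} \<Longrightarrow> \<phi> x = 0" "\<And>x. x \<notin> {c..d} \<Longrightarrow> deriv \<phi> x = 0"
      using test_fun_support[OF \<phi> \<open>a < b\<close>] by metis
    note int = loc_integrable_mult_compact_support[OF g_loc test_fun_continuous(1)[OF \<phi>] cd(1,3,4)]
      loc_integrable_mult_compact_support[OF P_loc test_fun_continuous(2)[OF \<phi>] cd(1,3,5)]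
      loc_integrable_mult_compact_support[OF loc_integrable_const[of _ _ k] test_fun_continuous(2)[OF \<phi>] cd(1,3,5)]
    have prim: "primitive h b = (LINT x|leb a b. h x)" if "\<And>x. x < a \<Longrightarrow> h x = 0" for h :: "real \<Rightarrow> real"
      unfolding primitive_def integral_leb set_lebesgue_integral_def
    proof (intro Bochner_Integration.integral_cong refl)
      fix x show "indicator {..b} x *\<^sub>R h x = indicator {a..b} x *\<^sub>R h x"
        using that[of x] by (cases "x < a") (auto simp: indicator_def)
    qed
    have "\<phi> b = 0" using cd by auto
    have neg: "u x = 0" "deriv \<phi> x = 0" if "x < a" for x
      using that cd by (auto simp: u_def)
    have "(LINT x|leb a b. u x * \<phi> x + primitive u x * deriv \<phi> x) = primitive (\<lambda>x. u x * \<phi> x + primitive u x * deriv \<phi> x) b"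
      using neg by (intro prim[symmetric]) simp
    also have "\<dots> = primitive u b * primitive (deriv \<phi>) b"
      using primitive_mult[OF u primitive_deriv_test_fun(1)[OF \<phi> \<open>a < b\<close>], of b]
      by (simp add: primitive_deriv_test_fun(2)[OF \<phi> \<open>a < b\<close>])
    also have "\<dots> = 0"
      by (simp add: primitive_deriv_test_fun(2)[OF \<phi> \<open>a < b\<close>] \<open>\<phi> b = 0\<close>)
    also have "(LINT x|leb a b. u x * \<phi> x + primitive u x * deriv \<phi> x) = (LINT x|leb a b. g x * \<phi> x + primitive u x * deriv \<phi> x)"
      by (intro Bochner_Integration.integral_cong refl) (auto simp: leb_def u_def)
    finally have 1: "(LINT x|leb a b. g x * \<phi> x) + (LINT x|leb a b. primitive u x * deriv \<phi> x) = 0"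
      using int by simp
    have "(LINT x|leb a b. deriv \<phi> x) = 0"
      using prim[of "deriv \<phi>"] neg(2) primitive_deriv_test_fun(2)[OF \<phi> \<open>a < b\<close>, of b] \<open>\<phi> b = 0\<close> by simp
    then have "(LINT x|leb a b. k * deriv \<phi> x) = 0" by simp
    moreover have "(LINT x|leb a b. (k + primitive u x) * deriv \<phi> x) = (LINT x|leb a b. k * deriv \<phi> x) + (LINT x|leb a b. primitive u x * deriv \<phi> x)"
      using int by (simp add: distrib_right)
    ultimately show ?thesis using 1 by linarith
  qed
  moreover have "loc_integrable a b (\<lambda>x. k + primitive u x)"
    unfolding loc_integrable_def
    by (auto intro!: borel_integrable_atLeastAtMost' continuous_intros primitive_continuous u)
  ultimately show ?thesis
    using g_loc by (simp add: has_weak_deriv_def u_def)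
qed

lemma has_weak_deriv_cong_AE:
  assumes "has_weak_deriv a b f g" and "f' \<in> borel_measurable (leb a b)"
    and AE: "AE x in leb a b. f' x = f x" and "a < b"
  shows "has_weak_deriv a b f' g"
proof -
  have m: "f \<in> borel_measurable (leb a b)"
    using assms loc_integrable_measurable by (auto simp: has_weak_deriv_def)
  have "loc_integrable a b f'"
    unfolding loc_integrable_def
  proof safe
    fix c d assume cd: "a < c" "d < b"
    have *: "(\<lambda>x. indicator {c..d} x *\<^sub>R h x) \<in> borel_measurable lborel" if "h \<in> borel_measurable (leb a b)" for h :: "real \<Rightarrow> real"
    proof -
      have [measurable]: "(\<lambda>x. indicator {a..b} x *\<^sub>R h x) \<in> borel_measurable lborel"
        using that unfolding leb_def by (subst (asm) borel_measurable_restrict_space_iff) auto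
      have "(\<lambda>x. indicator {c..d} x *\<^sub>R (indicator {a..b} x *\<^sub>R h x)) \<in> borel_measurable lborel"
        by measurable
      also have "(\<lambda>x. indicator {c..d} x *\<^sub>R (indicator {a..b} x *\<^sub>R h x)) = (\<lambda>x. indicator {c..d} x *\<^sub>R h x)"
        using cd by (auto simp: indicator_def)
      finally show ?thesis .
    qed
    have "AE x in lborel. indicator {c..d} x *\<^sub>R f x = indicator {c..d} x *\<^sub>R f' x"
      using AE unfolding AE_leb by eventually_elim (use cd in \<open>auto simp: indicator_def\<close>)
    moreover have "set_integrable lborel {c..d} f"
      using assms cd by (auto simp: has_weak_deriv_def loc_integrable_def)
    ultimately show "set_integrable lborel {c..d} f'"
      using *[OF m] *[OF assms(2)] unfolding set_integrable_def
      by (subst (asm) integrable_cong_AE[where g="\<lambda>x. indicator {c..d} x *\<^sub>R f' x"]) auto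
  qed
  moreover have "(LINT x|leb a b. f' x * deriv \<phi> x) = (LINT x|leb a b. f x * deriv \<phi> x)"
    if \<phi>: "test_fun a b \<phi>" for \<phi>
  proof (rule integral_cong_AE)
    have [measurable]: "deriv \<phi> \<in> borel_measurable (leb a b)"
      using test_fun_continuous(2)[OF \<phi>, of UNIV] unfolding leb_def
      by (intro measurable_restrict_space1) (simp add: borel_measurable_continuous_onI)
    show "(\<lambda>x. f' x * deriv \<phi> x) \<in> borel_measurable (leb a b)" "(\<lambda>x. f x * deriv \<phi> x) \<in> borel_measurable (leb a b)"
      using m assms(2) by measurable
    show "AE x in leb a b. f' x * deriv \<phi> x = f x * deriv \<phi> x"
      using AE by eventually_elim simp
  qed
  ultimately show ?thesis using assms(1) by (auto simp: has_weak_deriv_def)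
qed

lemma integrable_mult_test_fun:
  assumes "loc_integrable a b f" and \<phi>: "test_fun a b \<phi>" and "a < b"
  shows "integrable (leb a b) (\<lambda>x. f x * \<phi> x)" "integrable (leb a b) (\<lambda>x. f x * deriv \<phi> x)"
proof -
  obtain c d where "a < c" "c < d" "d < b"
    "\<And>x. x \<notin> {c..d} \<Longrightarrow> \<phi> x = 0" "\<And>x. x \<notin> {c..d} \<Longrightarrow> deriv \<phi> x = 0"
    using test_fun_support[OF \<phi> \<open>a < b\<close>] by metis
  note cd = this
  show "integrable (leb a b) (\<lambda>x. f x * \<phi> x)"
    by (rule loc_integrable_mult_compact_support[OF assms(1) test_fun_continuous(1)[OF \<phi>] cd(1,3,4)])
  show "integrable (leb a b) (\<lambda>x. f x * deriv \<phi> x)"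
    by (rule loc_integrable_mult_compact_support[OF assms(1) test_fun_continuous(2)[OF \<phi>] cd(1,3,5)])
qed

text \<open>By \<open>weak_deriv_primitive\<close> the difference of both sides has weak derivative zero, so it is constant
  by the lemma of du Bois-Reymond.\<close>

lemma weak_deriv_representation:
  assumes f: "has_weak_deriv a b f g" and g: "integrable (leb a b) g" and "a < b"
  shows "\<exists>k. AE x in leb a b. f x = k + primitive (\<lambda>t. indicator {a..b} t * g t) x"
proof -
  define P where "P = (\<lambda>x. 0 + primitive (\<lambda>t. indicator {a..b} t * g t) x)"
  have P: "has_weak_deriv a b P g" unfolding P_def by (rule weak_deriv_primitive[OF g \<open>a < b\<close>])
  have loc: "loc_integrable a b f" "loc_integrable a b P" using f P by (auto simp: has_weak_deriv_def)
  have "\<exists>k. AE x in leb a b. f x - 1 * P x = k"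
  proof (rule du_bois_reymond[OF loc_integrable_lincomb[OF loc] \<open>a < b\<close>])
    fix \<phi> assume \<phi>: "test_fun a b \<phi>"
    have "(LINT x|leb a b. (f x - 1 * P x) * deriv \<phi> x)
        = (LINT x|leb a b. f x * deriv \<phi> x) - (LINT x|leb a b. P x * deriv \<phi> x)"
      using integrable_mult_test_fun(2)[OF loc(1) \<phi> \<open>a < b\<close>] integrable_mult_test_fun(2)[OF loc(2) \<phi> \<open>a < b\<close>]
      by (simp add: left_diff_distrib)
    then show "(LINT x|leb a b. (f x - 1 * P x) * deriv \<phi> x) = 0"
      using f P \<phi> by (simp add: has_weak_deriv_def)
  qed
  then obtain k where "AE x in leb a b. f x - 1 * P x = k" by blast
  then have "AE x in leb a b. f x = k + primitive (\<lambda>t. indicator {a..b} t * g t) x"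
    by eventually_elim (simp add: P_def)
  then show ?thesis by blast
qed

text \<open>This makes the choice in the definition of \<open>weak_deriv\<close> harmless: integrability and estimates can be
  transferred from any weak derivative to the chosen one.\<close>

lemma weak_deriv_unique:
  assumes g: "has_weak_deriv a b f g" and h: "has_weak_deriv a b f h" and "a < b"
  shows "AE x in leb a b. g x = h x"
proof -
  have loc: "loc_integrable a b g" "loc_integrable a b h" using g h by (auto simp: has_weak_deriv_def)
  have "AE x in leb a b. g x - 1 * h x = 0"
  proof (rule fundamental_lemma[OF loc_integrable_lincomb[OF loc]])
    fix \<phi> assume \<phi>: "test_fun a b \<phi>"
    have "(LINT x|leb a b. (g x - 1 * h x) * \<phi> x)
        = (LINT x|leb a b. g x * \<phi> x) - (LINT x|leb a b. h x * \<phi> x)"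
      using integrable_mult_test_fun(1)[OF loc(1) \<phi> \<open>a < b\<close>] integrable_mult_test_fun(1)[OF loc(2) \<phi> \<open>a < b\<close>]
      by (simp add: left_diff_distrib)
    moreover have "(LINT x|leb a b. f x * deriv \<phi> x) = - (LINT x|leb a b. g x * \<phi> x)"
      "(LINT x|leb a b. f x * deriv \<phi> x) = - (LINT x|leb a b. h x * \<phi> x)"
      using g h \<phi> unfolding has_weak_deriv_def by blast+
    ultimately show "(LINT x|leb a b. (g x - 1 * h x) * \<phi> x) = 0" by linarith
  qed
  then show ?thesis by eventually_elim simp
qed

lemma has_weak_deriv_weak_deriv:
  "has_weak_deriv a b f g \<Longrightarrow> has_weak_deriv a b f (weak_deriv a b f)"
  unfolding weak_deriv_def using someI_ex[of "has_weak_deriv a b f"] by blast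

lemma weak_deriv_AE_eq:
  "has_weak_deriv a b f g \<Longrightarrow> a < b \<Longrightarrow> AE x in leb a b. weak_deriv a b f x = g x"
  using has_weak_deriv_weak_deriv weak_deriv_unique by blast

lemma weak_deriv_measurable:
  "has_weak_deriv a b f g \<Longrightarrow> a < b \<Longrightarrow> g \<in> borel_measurable (leb a b)"
  "has_weak_deriv a b f g \<Longrightarrow> a < b \<Longrightarrow> f \<in> borel_measurable (leb a b)"
  using loc_integrable_measurable unfolding has_weak_deriv_def by blast+

lemma integrable_weak_deriv:
  assumes f: "has_weak_deriv a b f g" and g: "integrable (leb a b) g" and "a < b"
  shows "integrable (leb a b) (weak_deriv a b f)"
  using integrable_cong_AE[THEN iffD2, OF _ _ weak_deriv_AE_eq[OF f \<open>a < b\<close>] g]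
    weak_deriv_measurable(1)[OF f \<open>a < b\<close>]
    weak_deriv_measurable(1)[OF has_weak_deriv_weak_deriv[OF f] \<open>a < b\<close>] by blast

lemma weak_deriv_bounded:
  assumes f: "has_weak_deriv a b f g" and g: "integrable (leb a b) g" and "a < b"
  shows "\<exists>B. AE x in leb a b. \<bar>f x\<bar> \<le> B"
proof -
  obtain k where k: "AE x in leb a b. f x = k + primitive (\<lambda>t. indicator {a..b} t * g t) x"
    using weak_deriv_representation[OF assms] by blast
  have u: "integrable lborel (\<lambda>t. indicator {a..b} t * g t)"
    using g by (simp add: integrable_leb set_integrable_def)
  from k have "AE x in leb a b. \<bar>f x\<bar> \<le> \<bar>k\<bar> + (LINT t|lborel. \<bar>indicator {a..b} t * g t\<bar>)"
  proof eventually_elim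
    case (elim x)
    then show ?case using primitive_bounded[OF u, of x] by linarith
  qed
  then show ?thesis by blast
qed

text \<open>Both factors are replaced by a constant plus a primitive. The product is again of this form by
  \<open>primitive_mult\<close>, and the new integrand is integrable because primitives are bounded.\<close>

lemma weak_deriv_mult:
  assumes f1: "has_weak_deriv a b f1 g1" and f2: "has_weak_deriv a b f2 g2"
    and g1: "integrable (leb a b) g1" and g2: "integrable (leb a b) g2" and "a < b"
  shows "\<exists>p. has_weak_deriv a b (\<lambda>x. f1 x * f2 x) p \<and> integrable (leb a b) p"
proof -
  define u1 where "u1 = (\<lambda>t. indicator {a..b} t * g1 t)"
  define u2 where "u2 = (\<lambda>t. indicator {a..b} t * g2 t)"
  have u1: "integrable lborel u1" and u2: "integrable lborel u2"
    using g1 g2 by (simp_all add: integrable_leb set_integrable_def u1_def u2_def)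
  obtain k1 where k1: "AE x in leb a b. f1 x = k1 + primitive u1 x"
    using weak_deriv_representation[OF f1 g1 \<open>a < b\<close>] by (auto simp: u1_def)
  obtain k2 where k2: "AE x in leb a b. f2 x = k2 + primitive u2 x"
    using weak_deriv_representation[OF f2 g2 \<open>a < b\<close>] by (auto simp: u2_def)
  define p where "p = (\<lambda>t. k1 * u2 t + k2 * u1 t + (u1 t * primitive u2 t + primitive u1 t * u2 t))"
  have i12: "integrable lborel (\<lambda>t. u1 t * primitive u2 t)"
    using u2 primitive_bounded[OF u2] by (intro integrable_mult_AE_bounded[OF u1] AE_I2) auto
  have "integrable lborel (\<lambda>t. u2 t * primitive u1 t)"
    using u1 primitive_bounded[OF u1] by (intro integrable_mult_AE_bounded[OF u2] AE_I2) auto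
  then have i21: "integrable lborel (\<lambda>t. primitive u1 t * u2 t)" by (simp add: mult.commute)
  have p: "integrable lborel p" unfolding p_def using u1 u2 i12 i21 by simp
  have p': "integrable (leb a b) p"
    unfolding integrable_leb set_integrable_def using p by (intro integrable_mult_indicator) auto
  have cut: "(\<lambda>t. indicator {a..b} t * p t) = p"
    by (auto simp: p_def u1_def u2_def indicator_def)
  have lin: "primitive (\<lambda>t. r * f t + s * g t + h t) x = r * primitive f x + s * primitive g x + primitive h x"
    if "integrable lborel f" "integrable lborel g" "integrable lborel h" for r s f g h x
  proof -
    have c: "integrable lborel (\<lambda>t. indicator {..x} t * f t)" if "integrable lborel f" for f :: "real \<Rightarrow> real"
      using integrable_mult_indicator[OF _ that, of "{..x}"] by simp
    have "primitive (\<lambda>t. r * f t + s * g t + h t) x = (LINT t|lborel. r * (indicator {..x} t * f t) + s * (indicator {..x} t * g t) + indicator {..x} t * h t)"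
      by (simp add: primitive_def set_lebesgue_integral_def algebra_simps)
    also have "\<dots> = r * primitive f x + s * primitive g x + primitive h x"
      using that[THEN c] by (simp add: primitive_def set_lebesgue_integral_def)
    finally show ?thesis .
  qed
  have eq: "(k1 + primitive u1 x) * (k2 + primitive u2 x) = k1 * k2 + primitive p x" for x
    using lin[OF u2 u1 Bochner_Integration.integrable_add[OF i12 i21], of k1 k2 x] primitive_mult[OF u1 u2, of x]
    by (simp add: p_def algebra_simps)
  have "has_weak_deriv a b (\<lambda>x. k1 * k2 + primitive p x) p"
    using weak_deriv_primitive[OF p' \<open>a < b\<close>, of "k1 * k2"] by (simp add: cut)
  then have "has_weak_deriv a b (\<lambda>x. f1 x * f2 x) p"
  proof (rule has_weak_deriv_cong_AE)
    show "(\<lambda>x. f1 x * f2 x) \<in> borel_measurable (leb a b)"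
      using weak_deriv_measurable(2)[OF f1 \<open>a < b\<close>] weak_deriv_measurable(2)[OF f2 \<open>a < b\<close>] by measurable
    show "AE x in leb a b. f1 x * f2 x = k1 * k2 + primitive p x"
      using k1 k2 by eventually_elim (simp add: eq)
  qed fact
  then show ?thesis using p' by blast
qed

text \<open>A weak derivative is only locally integrable, whereas the representation by a primitive needs an
  integrable one. Restriction to a compact subinterval of the interior provides it.\<close>

lemma has_weak_deriv_subinterval:
  assumes f: "has_weak_deriv a b f g" and sub: "a \<le> c" "c < d" "d \<le> b"
  shows "has_weak_deriv c d f g"
proof -
  have loc: "loc_integrable c d h" if "loc_integrable a b h" for h
    using that sub unfolding loc_integrable_def by force
  have "(LINT x|leb c d. f x * deriv \<phi> x) = - (LINT x|leb c d. g x * \<phi> x)" if \<phi>: "test_fun c d \<phi>" for \<phi>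
  proof -
    obtain l r where lr: "c < l" "l < r" "r < d"
      "\<And>x. x \<notin> {l..r} \<Longrightarrow> \<phi> x = 0" "\<And>x. x \<notin> {l..r} \<Longrightarrow> deriv \<phi> x = 0"
      using test_fun_support[OF \<phi> \<open>c < d\<close>] by metis
    have \<phi>': "test_fun a b \<phi>"
      using \<phi> sub unfolding test_fun_def by force
    have *: "(LINT x|leb c d. h x) = (LINT x|leb a b. h x)" if "\<And>x. x \<notin> {l..r} \<Longrightarrow> h x = 0" for h :: "real \<Rightarrow> real"
      unfolding integral_leb set_lebesgue_integral_def
    proof (intro Bochner_Integration.integral_cong refl)
      fix x show "indicator {c..d} x *\<^sub>R h x = indicator {a..b} x *\<^sub>R h x"
        using that[of x] lr sub by (cases "x \<in> {l..r}") auto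
    qed
    show ?thesis
      using * lr f \<phi>' by (simp add: has_weak_deriv_def)
  qed
  then show ?thesis using f loc by (auto simp: has_weak_deriv_def)
qed

section \<open>Weak derivatives of monotone functions\<close>

lemma continuous_AE_eq_imp_eq:
  assumes "continuous_on {c..d} f" "continuous_on {c..d} g" "c < d"
    and AE: "AE x in leb c d. f x = (g x :: real)" and x: "x \<in> {c..d}"
  shows "f x = g x"
proof -
  have cont: "continuous_on {c..d} (\<lambda>x. \<bar>f x - g x\<bar>)"
    by (intro continuous_intros assms)
  have "(LINT x:{c..d}|lborel. \<bar>f x - g x\<bar>) = (LINT x|leb c d. 0)"
    unfolding integral_leb[symmetric]
  proof (rule integral_cong_AE)
    show "(\<lambda>x. \<bar>f x - g x\<bar>) \<in> borel_measurable (leb c d)"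
      unfolding borel_measurable_leb by (rule borel_measurable_continuous_on_restrict[OF cont])
  qed (use AE in auto)
  then have "integral {c..d} (\<lambda>x. \<bar>f x - g x\<bar>) = 0"
    using set_borel_integral_eq_integral(2)[OF borel_integrable_atLeastAtMost'[OF cont]] by simp
  then have "((\<lambda>x. \<bar>f x - g x\<bar>) has_integral 0) (cbox c d)"
    using integrable_integral[OF integrable_continuous_real[OF cont]] by simp
  then have "\<bar>f x - g x\<bar> = 0"
    using has_integral_0_cbox_imp_0[of c d "\<lambda>x. \<bar>f x - g x\<bar>" x] cont \<open>c < d\<close> x by simp
  then show ?thesis by simp
qed

text \<open>
  On compact subintervals of the interior, \<open>\<Phi>\<close> is a primitive of \<open>g\<close>. Its increments are nonnegative,
  hence so is \<open>g\<close>, and Fatou's lemma for an exhaustion of the interval bounds the integral by the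
  total increment. In particular the weak derivative of a monotone function is integrable up to the
  boundary, which the definition of a weak derivative does not demand.
\<close>

lemma weak_deriv_monotone:
  assumes "a < b" and mono: "mono_on {a..b} \<Phi>" and cont: "continuous_on {a..b} \<Phi>"
    and g: "has_weak_deriv a b \<Phi> g"
  shows "AE x in leb a b. 0 \<le> g x" "integrable (leb a b) g" "(LINT x|leb a b. g x) \<le> \<Phi> b - \<Phi> a"
proof -
  have loc: "loc_integrable a b g" using g by (simp add: has_weak_deriv_def)
  have m: "g \<in> borel_measurable (leb a b)" by (rule weak_deriv_measurable(1)[OF g \<open>a < b\<close>])
  have FTC: "(LINT x:{c<..<d}|lborel. g x) = \<Phi> d - \<Phi> c" if cd: "a < c" "c < d" "d < b" for c d
  proof -
    define u where "u = (\<lambda>t. indicator {c..d} t * g t)"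
    have gi: "integrable (leb c d) g"
      using loc cd by (simp add: integrable_leb loc_integrable_def)
    then have u: "integrable lborel u"
      by (simp add: integrable_leb set_integrable_def u_def)
    obtain k where k: "AE x in leb c d. \<Phi> x = k + primitive u x"
      using weak_deriv_representation[OF has_weak_deriv_subinterval[OF g] gi] cd by (auto simp: u_def)
    have "\<Phi> x = k + primitive u x" if "x \<in> {c..d}" for x
    proof (rule continuous_AE_eq_imp_eq[OF _ _ \<open>c < d\<close> k that])
      show "continuous_on {c..d} \<Phi>" using cont by (rule continuous_on_subset) (use cd in auto)
      show "continuous_on {c..d} (\<lambda>x. k + primitive u x)"
        by (intro continuous_intros primitive_continuous u)
    qed
    then have "\<Phi> d - \<Phi> c = primitive u d - primitive u c" using cd by simp
    also have "\<dots> = (LINT x:{c<..<d}|lborel. u x)" using cd by (intro primitive_diff u) simp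
    also have "\<dots> = (LINT x:{c<..<d}|lborel. g x)"
      unfolding set_lebesgue_integral_def u_def
      by (intro Bochner_Integration.integral_cong refl) (auto simp: indicator_def)
    finally show ?thesis by simp
  qed
  show nonneg: "AE x in leb a b. 0 \<le> g x"
  proof (rule AE_nonneg_if_local_interval_integrals_nonneg[OF loc])
    fix c d assume cd: "a < c" "c < d" "d < b"
    then show "0 \<le> (LINT x:{c<..<d}|lborel. g x)"
      using FTC[OF cd] monotone_onD[OF mono, of c d] by simp
  qed
  \<comment> \<open>A third of the length keeps the exhausting intervals nonempty from the first index on.\<close>
  define \<delta> where "\<delta> = (b - a) / 3"
  have "\<delta> > 0" using \<open>a < b\<close> by (simp add: \<delta>_def)
  define c where "c n = a + \<delta> * (1 / real (Suc n))" for n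
  define d where "d n = b - \<delta> * (1 / real (Suc n))" for n
  have cd: "a < c n" "c n < d n" "d n < b" for n
  proof -
    have "\<delta> * (1 / real (Suc n)) \<le> \<delta>" using \<open>\<delta> > 0\<close> by (simp add: field_simps)
    moreover have "3 * \<delta> = b - a" by (simp add: \<delta>_def)
    ultimately show "c n < d n" using \<open>\<delta> > 0\<close> unfolding c_def d_def by linarith
  qed (use \<open>\<delta> > 0\<close> in \<open>auto simp: c_def d_def\<close>)
  have lim: "c \<longlonglongrightarrow> a" "d \<longlonglongrightarrow> b"
  proof -
    have "c \<longlonglongrightarrow> a + \<delta> * 0" "d \<longlonglongrightarrow> b - \<delta> * 0"
      unfolding c_def d_def by (intro tendsto_intros LIMSEQ_Suc[OF lim_1_over_n])+
    then show "c \<longlonglongrightarrow> a" "d \<longlonglongrightarrow> b" by simp_all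
  qed
  have "a \<le> b" using \<open>a < b\<close> by simp
  have bound: "(\<integral>\<^sup>+x. ennreal (indicator {c n<..<d n} x * g x) \<partial>leb a b) \<le> ennreal (\<Phi> b - \<Phi> a)" for n
  proof -
    have i: "set_integrable lborel {c n<..<d n} g"
      by (rule set_integrable_subset[of _ "{c n..d n}"])
         (use loc cd in \<open>auto simp: loc_integrable_def\<close>)
    have eq: "(\<lambda>x. indicator {a..b} x *\<^sub>R (indicator {c n<..<d n} x * g x)) = (\<lambda>x. indicator {c n<..<d n} x *\<^sub>R g x)"
      using cd[of n] by (auto simp: indicator_def)
    have "(\<integral>\<^sup>+x. ennreal (indicator {c n<..<d n} x * g x) \<partial>leb a b) = ennreal (LINT x|leb a b. indicator {c n<..<d n} x * g x)"
    proof (rule nn_integral_eq_integral)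
      show "integrable (leb a b) (\<lambda>x. indicator {c n<..<d n} x * g x)"
        using i unfolding integrable_leb set_integrable_def eq .
      show "AE x in leb a b. 0 \<le> indicator {c n<..<d n} x * g x"
        using nonneg by eventually_elim simp
    qed
    also have "(LINT x|leb a b. indicator {c n<..<d n} x * g x) = \<Phi> (d n) - \<Phi> (c n)"
      using FTC[OF cd, of n] unfolding integral_leb set_lebesgue_integral_def eq .
    also have "\<dots> \<le> \<Phi> b - \<Phi> a"
      using monotone_onD[OF mono, of a "c n"] monotone_onD[OF mono, of "d n" b] cd[of n] \<open>a \<le> b\<close> by simp
    finally show ?thesis by (simp add: ennreal_leI)
  qed
  have [measurable]: "(\<lambda>x. indicator {c n<..<d n} x * g x) \<in> borel_measurable (leb a b)" for n
  proof -
    have "(\<lambda>x. indicator {c n<..<d n} x :: real) \<in> borel_measurable (leb a b)"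
      unfolding leb_def by (rule measurable_restrict_space1) simp
    from borel_measurable_times[OF this m] show ?thesis .
  qed
  have "AE x in leb a b. liminf (\<lambda>n. ennreal (indicator {c n<..<d n} x * g x)) = ennreal (g x)"
  proof -
    have "AE x in leb a b. x \<noteq> a" "AE x in leb a b. x \<noteq> b"
      unfolding AE_leb using AE_lborel_singleton[of a] AE_lborel_singleton[of b] by auto
    moreover have "AE x in leb a b. x \<in> {a..b}" unfolding AE_leb by simp
    ultimately show ?thesis
    proof eventually_elim
      case (elim x)
      then have "a < x" "x < b" by auto
      have "eventually (\<lambda>n. ennreal (g x) = ennreal (indicator {c n<..<d n} x * g x)) sequentially"
        using order_tendstoD(2)[OF lim(1) \<open>a < x\<close>] order_tendstoD(1)[OF lim(2) \<open>x < b\<close>]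
        by eventually_elim simp
      then have "(\<lambda>n. ennreal (indicator {c n<..<d n} x * g x)) \<longlonglongrightarrow> ennreal (g x)"
        by (rule Lim_transform_eventually[OF tendsto_const])
      then show ?case by (simp add: lim_imp_Liminf)
    qed
  qed
  then have "(\<integral>\<^sup>+x. ennreal (g x) \<partial>leb a b) = (\<integral>\<^sup>+x. liminf (\<lambda>n. ennreal (indicator {c n<..<d n} x * g x)) \<partial>leb a b)"
    by (intro nn_integral_cong_AE) (auto elim: eventually_mono)
  also have "\<dots> \<le> liminf (\<lambda>n. \<integral>\<^sup>+x. ennreal (indicator {c n<..<d n} x * g x) \<partial>leb a b)"
    by (rule nn_integral_liminf) measurable
  also have "\<dots> \<le> ennreal (\<Phi> b - \<Phi> a)"
    using bound by (intro Liminf_le) auto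
  finally have nn: "(\<integral>\<^sup>+x. ennreal (g x) \<partial>leb a b) \<le> ennreal (\<Phi> b - \<Phi> a)" .
  show int: "integrable (leb a b) g"
    using nn by (intro integrableI_nonneg m nonneg) (auto intro: le_less_trans)
  have "0 \<le> \<Phi> b - \<Phi> a" using monotone_onD[OF mono, of a b] \<open>a < b\<close> by simp
  then show "(LINT x|leb a b. g x) \<le> \<Phi> b - \<Phi> a"
    using nn nn_integral_eq_integral[OF int nonneg] by (simp add: ennreal_le_iff)
qed

section \<open>The Helly space\<close>

lemma helly_range: "\<Phi> \<in> helly a b \<Longrightarrow> x \<in> {a..b} \<Longrightarrow> \<Phi> x \<in> {a..b}"
  by (auto simp: helly_def)

lemma helly_measurable: "\<Phi> \<in> helly a b \<Longrightarrow> \<Phi> \<in> borel_measurable (leb a b)"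
  unfolding borel_measurable_leb by (rule borel_measurable_mono_on_fnc) (simp add: helly_def)

lemma helly_abs_le: "\<Phi> \<in> helly a b \<Longrightarrow> x \<in> {a..b} \<Longrightarrow> \<bar>\<Phi> x\<bar> \<le> max \<bar>a\<bar> \<bar>b\<bar>"
  using helly_range[of \<Phi> a b x] by auto

lemma topspace_helly_space: "topspace (helly_space a b) = helly a b"
  by (auto simp: helly_space_def helly_def PiE_def)

lemma limitin_helly_space:
  assumes "\<And>n. xs n \<in> helly a b" "\<Phi> \<in> helly a b"
  shows "limitin (helly_space a b) xs \<Phi> sequentially \<longleftrightarrow> (\<forall>x\<in>{a..b}. (\<lambda>n. xs n x) \<longlonglongrightarrow> \<Phi> x)"
proof -
  have "\<Phi> \<in> extensional {a..b}" "\<And>n. xs n \<in> (\<Pi>\<^sub>E x\<in>{a..b}. UNIV)"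
    using assms by (auto simp: helly_def PiE_def)
  then show ?thesis
    using assms by (simp add: helly_space_def limitin_subtopology limitin_componentwise)
qed

section \<open>Measures with bounded density\<close>

lemma space_leb [simp]: "space (leb a b) = {a..b}"
  by (simp add: leb_def)

lemma emeasure_leb: "A \<in> sets (leb a b) \<Longrightarrow> emeasure (leb a b) A = emeasure lborel A"
  unfolding leb_def by (subst emeasure_restrict_space) (auto simp: sets_restrict_space)

lemma sets_leb_iff: "A \<in> sets (leb a b) \<longleftrightarrow> A \<in> sets borel \<and> A \<subseteq> {a..b}"
  unfolding leb_def by (subst sets_restrict_space_iff) auto

lemma finite_measure_leb: "finite_measure (leb a b)"
proof (rule finite_measureI)
  show "emeasure (leb a b) (space (leb a b)) \<noteq> \<infinity>"
    by (subst emeasure_leb) (auto simp: sets_leb_iff emeasure_lborel_Icc_eq)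
qed

lemma density_dens:
  assumes "finite_measure \<mu>" and "sets \<mu> = sets (leb a b)" and "absolutely_continuous (leb a b) \<mu>"
  shows "density (leb a b) (\<lambda>x. ennreal (dens a b \<mu> x)) = \<mu>"
proof -
  interpret finite_measure "leb a b" by (rule finite_measure_leb)
  interpret \<mu>: finite_measure \<mu> by fact
  have "density (leb a b) (\<lambda>x. ennreal (dens a b \<mu> x)) = density (leb a b) (RN_deriv (leb a b) \<mu>)"
  proof (rule density_cong)
    have "AE x in leb a b. RN_deriv (leb a b) \<mu> x \<noteq> \<infinity>"
      by (rule RN_deriv_finite) (use assms \<mu>.sigma_finite_measure_axioms in auto)
    then show "AE x in leb a b. ennreal (dens a b \<mu> x) = RN_deriv (leb a b) \<mu> x"
      by eventually_elim (simp add: dens_def less_top)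
  qed (auto simp: dens_def[abs_def])
  also have "\<dots> = \<mu>" using assms by (intro density_RN_deriv) auto
  finally show ?thesis .
qed

lemma dens_measurable [measurable]: "dens a b \<mu> \<in> borel_measurable (leb a b)"
  unfolding dens_def[abs_def] by measurable

lemma dens_nonneg: "0 \<le> dens a b \<mu> x"
  by (simp add: dens_def)

text \<open>If the density exceeded \<open>K\<close> on a set of positive measure, integrating it over that set would
  violate the bound.\<close>

lemma dens_le:
  assumes \<nu>: "finite_measure \<nu>" "sets \<nu> = sets (leb a b)" "absolutely_continuous (leb a b) \<nu>"
    and le: "\<And>A. A \<in> sets (leb a b) \<Longrightarrow> emeasure \<nu> A \<le> ennreal K * emeasure (leb a b) A"
    and "0 \<le> K"
  shows "AE x in leb a b. dens a b \<nu> x \<le> K"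
proof -
  interpret finite_measure "leb a b" by (rule finite_measure_leb)
  define A where "A = {x \<in> space (leb a b). K < dens a b \<nu> x}"
  have A [measurable]: "A \<in> sets (leb a b)" unfolding A_def by measurable
  let ?f = "\<lambda>x. ennreal K * indicator A x" and ?g = "\<lambda>x. ennreal (dens a b \<nu> x) * indicator A x"
  have f: "integral\<^sup>N (leb a b) ?f = ennreal K * emeasure (leb a b) A"
    by (simp add: nn_integral_cmult_indicator)
  have g: "integral\<^sup>N (leb a b) ?g = emeasure \<nu> A"
    using emeasure_density[of "\<lambda>x. ennreal (dens a b \<nu> x)" "leb a b" A] density_dens[OF \<nu>] by simp
  have "AE x in leb a b. ?g x \<le> ?f x"
  proof (rule ccontr)
    assume "\<not> ?thesis"
    then have "integral\<^sup>N (leb a b) ?f < integral\<^sup>N (leb a b) ?g"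
    proof (rule nn_integral_less[rotated -1])
      show "integral\<^sup>N (leb a b) ?f \<noteq> \<infinity>"
        unfolding f using emeasure_finite[of A] by (simp add: ennreal_mult_eq_top_iff)
      show "AE x in leb a b. ?f x \<le> ?g x"
        by (rule AE_I2) (auto simp: A_def indicator_def intro: ennreal_leI)
    qed measurable
    with le[OF A] show False unfolding f g by simp
  qed
  then show ?thesis
  proof (rule AE_mp[OF _ AE_I2], intro impI)
    fix x assume "x \<in> space (leb a b)" "?g x \<le> ?f x"
    then show "dens a b \<nu> x \<le> K"
      using \<open>0 \<le> K\<close> by (cases "x \<in> A") (auto simp: A_def ennreal_le_iff)
  qed
qed

section \<open>Bounds for the entropy\<close>

lemma emeasure_leb_space: "a < b \<Longrightarrow> emeasure (leb a b) {a..b} = ennreal (b - a)"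
  by (subst emeasure_leb) (auto simp: sets_leb_iff)

text \<open>The inequality \<open>ln y \<le> y - 1\<close> at \<open>y = 1 / r\<close> gives \<open>- r ln r \<le> 1 - r \<le> 1\<close>.\<close>

lemma Ent_lower_bound:
  assumes "a < b"
  shows "ereal (- (b - a)) \<le> Ent a b \<nu>"
proof (cases "absolutely_continuous (leb a b) \<nu>")
  case True
  let ?r = "dens a b \<nu>"
  have "- (r * ln r) \<le> 1" if "0 \<le> r" for r :: real
  proof (cases "r = 0")
    case False
    then have "r > 0" using that by simp
    then have "r * - ln r \<le> r * (1 / r - 1)"
      using ln_le_minus_one[of "1 / r"] by (intro mult_left_mono) (auto simp: ln_div)
    also have "\<dots> \<le> 1" using \<open>r > 0\<close> by (simp add: algebra_simps)
    finally show ?thesis by simp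
  qed simp
  then have "(\<integral>\<^sup>+x. ennreal (- (?r x * ln (?r x))) \<partial>leb a b) \<le> (\<integral>\<^sup>+x. ennreal 1 \<partial>leb a b)"
    by (intro nn_integral_mono ennreal_leI) (simp add: dens_nonneg)
  also have "\<dots> = ennreal (b - a)"
    by (simp add: emeasure_leb_space[OF assms])
  finally have "enn2ereal (\<integral>\<^sup>+x. ennreal (- (?r x * ln (?r x))) \<partial>leb a b) \<le> ereal (b - a)"
    using assms by (metis enn2ereal_ennreal less_eq_ennreal.rep_eq diff_ge_0_iff_ge less_imp_le)
  then have "0 - ereal (b - a) \<le> enn2ereal (\<integral>\<^sup>+x. ennreal (?r x * ln (?r x)) \<partial>leb a b)
      - enn2ereal (\<integral>\<^sup>+x. ennreal (- (?r x * ln (?r x))) \<partial>leb a b)"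
    by (intro ereal_minus_mono) auto
  then show ?thesis using True by (simp add: Ent_def)
qed (simp add: Ent_def)

text \<open>A crude bound suffices: the density \<open>r\<close> is at most \<open>K\<close>, and \<open>r ln r \<le> r * r\<close>.\<close>

lemma Ent_upper_bound:
  assumes "a < b" and \<nu>: "finite_measure \<nu>" "sets \<nu> = sets (leb a b)"
    and le: "\<And>A. A \<in> sets (leb a b) \<Longrightarrow> emeasure \<nu> A \<le> ennreal K * emeasure (leb a b) A"
    and "0 \<le> K"
  shows "Ent a b \<nu> \<le> ereal (K\<^sup>2 * (b - a))"
proof -
  let ?r = "dens a b \<nu>"
  have ac: "absolutely_continuous (leb a b) \<nu>"
    unfolding absolutely_continuous_def
  proof
    fix A assume "A \<in> null_sets (leb a b)"
    then show "A \<in> null_sets \<nu>"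
      using le[of A] \<nu>(2) by (auto simp: null_sets_def)
  qed
  have "r * ln r \<le> K\<^sup>2" if "0 \<le> r" "r \<le> K" for r
  proof (cases "r = 0")
    case False
    then have "r * ln r \<le> r * r"
      using that ln_le_minus_one[of r] by (intro mult_left_mono) auto
    also have "\<dots> \<le> K * K" using that by (intro mult_mono) auto
    finally show ?thesis by (simp add: power2_eq_square)
  qed simp
  then have "(\<integral>\<^sup>+x. ennreal (?r x * ln (?r x)) \<partial>leb a b) \<le> (\<integral>\<^sup>+x. ennreal (K\<^sup>2) \<partial>leb a b)"
    using dens_le[OF \<nu> ac le \<open>0 \<le> K\<close>]
    by (intro nn_integral_mono_AE) (auto elim!: eventually_mono intro!: ennreal_leI simp: dens_nonneg)
  also have "\<dots> = ennreal (K\<^sup>2 * (b - a))"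
    using assms by (simp add: emeasure_leb_space ennreal_mult)
  finally have "enn2ereal (\<integral>\<^sup>+x. ennreal (?r x * ln (?r x)) \<partial>leb a b) \<le> ereal (K\<^sup>2 * (b - a))"
    using assms by (metis enn2ereal_ennreal less_eq_ennreal.rep_eq diff_ge_0_iff_ge less_imp_le mult_nonneg_nonneg zero_le_power2)
  then have "enn2ereal (\<integral>\<^sup>+x. ennreal (?r x * ln (?r x)) \<partial>leb a b)
      - enn2ereal (\<integral>\<^sup>+x. ennreal (- (?r x * ln (?r x))) \<partial>leb a b) \<le> ereal (K\<^sup>2 * (b - a)) - 0"
    by (intro ereal_minus_mono) auto
  then show ?thesis using ac by (simp add: Ent_def)
qed

section \<open>Push-forward under an expanding map\<close>

lemma emeasure_le_diameter:
  assumes S: "S \<subseteq> {a..b}" and D: "\<And>s t. s \<in> S \<Longrightarrow> t \<in> S \<Longrightarrow> t - s \<le> D"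
  shows "emeasure lborel S \<le> ennreal D"
proof (cases "S = {}")
  case False
  have bdd: "bdd_below S" "bdd_above S" using S by (auto intro: bdd_below_mono bdd_above_mono)
  have "t - D \<le> Inf S" if "t \<in> S" for t
    using D[OF _ that] False by (intro cInf_greatest) (auto simp: algebra_simps)
  then have "Sup S \<le> Inf S + D"
    using False by (intro cSup_least) (auto simp: algebra_simps)
  moreover have "S \<subseteq> {Inf S..Sup S}" using bdd by (auto intro: cInf_lower cSup_upper)
  then have "emeasure lborel S \<le> emeasure lborel {Inf S..Sup S}" by (rule emeasure_mono) simp
  moreover have "Inf S \<le> Sup S" using bdd False by (metis cInf_le_cSup)
  ultimately show ?thesis by (auto intro: order_trans simp: ennreal_leI)
qed simp

text \<open>The preimage of an interval has diameter at most its length divided by \<open>\<delta>\<close>, because \<open>\<Phi>\<close> expands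
  distances. This gives the bound for intervals, and the comparison principle for finite measures
  extends it to Borel sets.\<close>

lemma emeasure_distr_expanding_le:
  assumes \<mu>: "\<mu> = density (leb a b) (\<lambda>x. ennreal (m x))" "finite_measure \<mu>"
    and m: "m \<in> borel_measurable (leb a b)" "AE x in leb a b. m x \<le> B" "0 \<le> B"
    and \<Phi>: "\<Phi> \<in> helly a b"
    and \<delta>: "\<delta> > 0" "\<And>x y. x \<in> {a..b} \<Longrightarrow> y \<in> {a..b} \<Longrightarrow> x \<le> y \<Longrightarrow> \<delta> * (y - x) \<le> \<Phi> y - \<Phi> x"
    and A: "A \<in> sets (leb a b)"
  shows "emeasure (distr \<mu> (leb a b) \<Phi>) A \<le> ennreal (B / \<delta>) * emeasure (leb a b) A"
proof -
  interpret \<mu>: finite_measure \<mu> by fact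
  have [simp]: "space \<mu> = {a..b}" and sets: "sets \<mu> = sets (leb a b)" using \<mu> by simp_all
  have me: "\<Phi> \<in> borel_measurable \<mu>"
    using helly_measurable[OF \<Phi>] sets measurable_cong_sets[OF sets refl] by blast
  have me': "\<Phi> \<in> measurable \<mu> (leb a b)"
    unfolding leb_def by (rule measurable_restrict_space2) (use me helly_range[OF \<Phi>] in auto)
  define M where "M = distr \<mu> borel \<Phi>"
  define N where "N = density lborel (\<lambda>x. ennreal (B / \<delta>) * indicator {a..b} x)"
  have emN: "emeasure N S = ennreal (B / \<delta>) * emeasure lborel ({a..b} \<inter> S)" if [measurable]: "S \<in> sets borel" for S
  proof -
    have "emeasure N S = (\<integral>\<^sup>+x. ennreal (B / \<delta>) * indicator ({a..b} \<inter> S) x \<partial>lborel)"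
      unfolding N_def by (subst emeasure_density) (auto intro!: nn_integral_cong simp: indicator_def)
    then show ?thesis by (simp add: nn_integral_cmult_indicator)
  qed
  have N: "finite_borel_measure N"
  proof (intro finite_borel_measure.intro finite_measureI finite_borel_measure_axioms.intro)
    have "emeasure N UNIV \<noteq> \<infinity>"
      by (subst emN) (auto simp: ennreal_mult_eq_top_iff emeasure_lborel_Icc_eq)
    then show "emeasure N (space N) \<noteq> \<infinity>" by (simp add: N_def)
  qed (simp add: N_def)
  have M: "finite_borel_measure M"
  proof (intro finite_borel_measure.intro finite_borel_measure_axioms.intro)
    show "finite_measure M" unfolding M_def by (rule \<mu>.finite_measure_distr[OF me])
  qed (simp add: M_def)
  interpret M: finite_borel_measure M by fact
  interpret N: finite_borel_measure N by fact
  have "measure M {x<..y} \<le> measure N {x<..y}" if "x < y" for x y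
  proof -
    define S where "S = \<Phi> -` {x<..y} \<inter> {a..b}"
    \<comment> \<open>The length of the part of the interval inside \<open>{a..b}\<close>; it may be negative when \<open>S\<close> is empty.\<close>
    define D where "D = min y b - max x a"
    have S: "S \<in> sets (leb a b)"
      using measurable_sets[OF me, of "{x<..y}"] sets by (simp add: S_def)
    have "emeasure M {x<..y} = emeasure \<mu> S"
      unfolding M_def S_def by (subst emeasure_distr[OF me]) auto
    also have "\<dots> = (\<integral>\<^sup>+x. ennreal (m x) * indicator S x \<partial>leb a b)"
      unfolding \<mu>(1) using m(1) S by (intro emeasure_density) auto
    also have "\<dots> \<le> (\<integral>\<^sup>+x. ennreal B * indicator S x \<partial>leb a b)"
      using m(2) by (intro nn_integral_mono_AE) (auto elim!: eventually_mono intro!: mult_right_mono ennreal_leI)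
    also have "\<dots> = ennreal B * emeasure lborel S"
      using S by (simp add: nn_integral_cmult_indicator emeasure_leb)
    also have "\<dots> \<le> ennreal B * ennreal (D / \<delta>)"
    proof (intro mult_left_mono emeasure_le_diameter[where a=a and b=b])
      show "S \<subseteq> {a..b}" by (auto simp: S_def)
      fix s t assume st: "s \<in> S" "t \<in> S"
      have "\<Phi> s \<in> {a..b}" "\<Phi> t \<in> {a..b}" using st helly_range[OF \<Phi>] by (auto simp: S_def)
      then have "\<Phi> t - \<Phi> s \<le> D" "0 \<le> D" using st by (auto simp: S_def D_def)
      show "t - s \<le> D / \<delta>"
      proof (cases "s \<le> t")
        case True
        then have "\<delta> * (t - s) \<le> D" using \<delta>(2)[of s t] st \<open>\<Phi> t - \<Phi> s \<le> D\<close> by (auto simp: S_def)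
        then show ?thesis using \<delta>(1) by (simp add: field_simps)
      next
        case False
        then have "t - s \<le> 0" by simp
        also have "0 \<le> D / \<delta>" using \<open>0 \<le> D\<close> \<delta>(1) by simp
        finally show ?thesis .
      qed
    qed simp
    also have "\<dots> = ennreal (B / \<delta>) * ennreal D"
      using \<delta>(1) m(3) by (simp flip: ennreal_mult' ennreal_mult'')
    also have "ennreal D \<le> emeasure lborel ({a..b} \<inter> {x<..y})"
    proof -
      have "emeasure lborel {max x a<..<min y b} \<le> emeasure lborel ({a..b} \<inter> {x<..y})"
        by (rule emeasure_mono) auto
      then show ?thesis unfolding D_def
        by (cases "max x a \<le> min y b") (auto simp: ennreal_neg)
    qed
    then have "ennreal (B / \<delta>) * ennreal D \<le> emeasure N {x<..y}"
      by (subst emN) (auto intro!: mult_left_mono)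
    finally show ?thesis by (simp add: M.emeasure_eq_measure N.emeasure_eq_measure)
  qed
  from finite_borel_measure_le_if_intervals_le[OF M N this, of A]
  have "emeasure M A \<le> emeasure N A"
    using A by (simp add: sets_leb_iff M.emeasure_eq_measure N.emeasure_eq_measure ennreal_leI)
  moreover have "emeasure (distr \<mu> (leb a b) \<Phi>) A = emeasure M A"
    using A unfolding M_def by (subst (1 2) emeasure_distr) (auto simp: me me' sets_leb_iff)
  moreover have "emeasure N A = ennreal (B / \<delta>) * emeasure (leb a b) A"
    using A by (simp add: emN emeasure_leb sets_leb_iff Int_absorb1)
  ultimately show ?thesis by simp
qed

section \<open>The linear part is a small perturbation of its limit\<close>

lemma abs_integral_mult_le:
  fixes g h :: "'a \<Rightarrow> real"
  assumes g: "integrable M g" "AE x in M. 0 \<le> g x"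
    and h: "h \<in> borel_measurable M" "AE x in M. \<bar>h x\<bar> \<le> B"
  shows "\<bar>LINT x|M. g x * h x\<bar> \<le> B * (LINT x|M. g x)"
proof -
  have "\<bar>LINT x|M. g x * h x\<bar> \<le> (LINT x|M. \<bar>g x * h x\<bar>)" by (rule integral_abs_bound)
  also have "\<dots> \<le> (LINT x|M. B * g x)"
  proof (rule integral_mono_AE)
    show "integrable M (\<lambda>x. \<bar>g x * h x\<bar>)"
      by (intro integrable_abs integrable_mult_AE_bounded[OF g(1) h])
    show "AE x in M. \<bar>g x * h x\<bar> \<le> B * g x"
      using g(2) h(2)
    proof eventually_elim
      case (elim x)
      then show ?case using mult_right_mono[of "\<bar>h x\<bar>" B "g x"] by (simp add: abs_mult mult.commute)
    qed
  qed (use g in simp)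
  finally show ?thesis by simp
qed

lemma AE_space_leb: "AE x in leb a b. x \<in> {a..b}"
  by (simp add: AE_leb)

text \<open>Each of the two formulas for the functional is the integral of \<open>\<Phi> w m\<close> plus \<open>\<alpha>\<close> times a remainder,
  and \<open>C1\<close> and \<open>C2\<close> bound the respective remainders. The first bound uses that the weak derivative of
  \<open>\<Phi>\<close> has mass at most \<open>b - a\<close>, the second that \<open>\<Phi>\<close> is bounded and takes prescribed boundary values,
  so that the boundary terms add up to a constant \<open>K\<close>.\<close>

lemma f_fun_perturbation:
  assumes "a < b"
    and \<mu>: "\<mu> = density (leb a b) (\<lambda>x. ennreal (dens a b \<mu> x))"
    and m: "has_weak_deriv a b (dens a b \<mu>) m'" "integrable (leb a b) m'"
    and w: "integrable (leb a b) w" "has_weak_deriv a b w w'" "integrable (leb a b) w'"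
    and w': "has_weak_deriv a b w' w''" "integrable (leb a b) w''"
  shows "\<exists>C. \<forall>\<Phi>\<in>helly a b. \<forall>\<alpha>.
    \<bar>f_fun a b \<mu> \<alpha> w \<Phi> - (LINT x|leb a b. \<Phi> x * (w x * dens a b \<mu> x))\<bar> \<le> \<bar>\<alpha>\<bar> * C"
proof -
  define m where "m = dens a b \<mu>"
  define dw where "dw = weak_deriv a b w"
  define p where "p = weak_deriv a b (\<lambda>y. m y * dw y)"
  define q where "q = weak_deriv a b m"
  have [measurable]: "m \<in> borel_measurable (leb a b)" unfolding m_def by measurable
  have dw_meas [measurable]: "dw \<in> borel_measurable (leb a b)"
    unfolding dw_def by (rule weak_deriv_measurable(1)[OF has_weak_deriv_weak_deriv[OF w(2)] \<open>a < b\<close>])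
  have dw: "has_weak_deriv a b dw w''"
    by (rule has_weak_deriv_cong_AE[OF w'(1) dw_meas _ \<open>a < b\<close>])
       (simp add: dw_def weak_deriv_AE_eq[OF w(2) \<open>a < b\<close>])
  have m_nonneg: "0 \<le> m x" for x by (simp add: m_def dens_nonneg)
  obtain Bm where Bm: "AE x in leb a b. \<bar>m x\<bar> \<le> Bm"
    using weak_deriv_bounded[OF m \<open>a < b\<close>] by (auto simp: m_def)
  obtain Bw where Bw: "AE x in leb a b. \<bar>dw x\<bar> \<le> Bw"
    using weak_deriv_bounded[OF dw w'(2) \<open>a < b\<close>] by auto
  have p: "integrable (leb a b) p"
    using weak_deriv_mult[OF m(1) dw m(2) w'(2) \<open>a < b\<close>] integrable_weak_deriv[OF _ _ \<open>a < b\<close>]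
    unfolding p_def m_def by blast
  have q: "integrable (leb a b) q"
    unfolding q_def m_def by (rule integrable_weak_deriv[OF m \<open>a < b\<close>])
  have wm: "integrable (leb a b) (\<lambda>x. w x * m x)"
    by (rule integrable_mult_AE_bounded[OF w(1) _ Bm]) measurable
  define L where "L = max \<bar>a\<bar> \<bar>b\<bar>"
  define K where "K = cont_rep a b m b * cont_rep a b dw b * b - cont_rep a b m a * cont_rep a b dw a * a
      - (cont_rep a b m b * b - cont_rep a b m a * a)"
  define C1 where "C1 = \<bar>Bm * Bw + Bm\<bar> * (b - a)"
  define C2 where "C2 = L * (LINT x|leb a b. \<bar>q x - p x\<bar>) + \<bar>K\<bar>"
  have int\<mu>: "(LINT x|\<mu>. h x) = (LINT x|leb a b. m x * h x)" if "h \<in> borel_measurable (leb a b)" for h :: "real \<Rightarrow> real"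
    by (subst \<mu>, subst integral_density) (use that m_nonneg in \<open>auto simp: m_def[symmetric]\<close>)
  have "\<bar>f_fun a b \<mu> \<alpha> w \<Phi> - (LINT x|leb a b. \<Phi> x * (w x * m x))\<bar> \<le> \<bar>\<alpha>\<bar> * max C1 C2"
    if \<Phi>: "\<Phi> \<in> helly a b" for \<Phi> \<alpha>
  proof -
    have [measurable]: "\<Phi> \<in> borel_measurable (leb a b)" by (rule helly_measurable[OF \<Phi>])
    have \<Phi>L: "AE x in leb a b. \<bar>\<Phi> x\<bar> \<le> L"
      using AE_space_leb by eventually_elim (use helly_abs_le[OF \<Phi>] in \<open>simp add: L_def\<close>)
    have bc: "\<Phi> a = a" "\<Phi> b = b" using \<Phi> by (auto simp: helly_def)
    have "integrable (leb a b) (\<lambda>x. (w x * m x) * \<Phi> x)"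
      by (rule integrable_mult_AE_bounded[OF wm _ \<Phi>L]) measurable
    then have main: "integrable (leb a b) (\<lambda>x. \<Phi> x * (w x * m x))" by (simp add: mult.commute)
    show ?thesis
    proof (cases "weakly_differentiable a b \<Phi> \<and> continuous_on {a..b} \<Phi>")
      case True
      define g where "g = weak_deriv a b \<Phi>"
      have wd: "has_weak_deriv a b \<Phi> g"
        using True has_weak_deriv_weak_deriv unfolding weakly_differentiable_def g_def by blast
      have mono: "mono_on {a..b} \<Phi>" using \<Phi> by (simp add: helly_def)
      note g = weak_deriv_monotone[OF \<open>a < b\<close> mono conjunct2[OF True] wd]
      have [measurable]: "g \<in> borel_measurable (leb a b)" using g(2) by (rule borel_measurable_integrable)
      have [measurable]: "w \<in> borel_measurable (leb a b)" using w(1) by (rule borel_measurable_integrable)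
      have h1: "AE x in leb a b. \<bar>m x * dw x\<bar> \<le> Bm * Bw"
        using Bm Bw by eventually_elim (simp add: abs_mult mult_mono')
      have i1: "integrable (leb a b) (\<lambda>x. g x * (m x * dw x))" "integrable (leb a b) (\<lambda>x. g x * m x)"
        by (rule integrable_mult_AE_bounded[OF g(2) _ h1], measurable)
           (rule integrable_mult_AE_bounded[OF g(2) _ Bm], measurable)
      have "f_fun a b \<mu> \<alpha> w \<Phi> = (LINT x|\<mu>. \<Phi> x * w x + \<alpha> * g x * dw x) - (LINT x|\<mu>. \<alpha> * g x)"
        using True by (simp add: f_fun_def Let_def g_def dw_def)
      also have "\<dots> = (LINT x|leb a b. \<Phi> x * (w x * m x) + \<alpha> * (g x * (m x * dw x))) - (LINT x|leb a b. \<alpha> * (g x * m x))"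
        by (subst (1 2) int\<mu>) (measurable, auto simp: algebra_simps)
      also have "\<dots> = (LINT x|leb a b. \<Phi> x * (w x * m x)) + \<alpha> * ((LINT x|leb a b. g x * (m x * dw x)) - (LINT x|leb a b. g x * m x))"
        using main i1 by (simp add: algebra_simps)
      finally have "\<bar>f_fun a b \<mu> \<alpha> w \<Phi> - (LINT x|leb a b. \<Phi> x * (w x * m x))\<bar>
          = \<bar>\<alpha>\<bar> * \<bar>(LINT x|leb a b. g x * (m x * dw x)) - (LINT x|leb a b. g x * m x)\<bar>"
        by (simp add: abs_mult)
      also have "\<bar>(LINT x|leb a b. g x * (m x * dw x)) - (LINT x|leb a b. g x * m x)\<bar> \<le> C1"
      proof -
        have "\<bar>LINT x|leb a b. g x * (m x * dw x)\<bar> \<le> Bm * Bw * (LINT x|leb a b. g x)"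
          by (rule abs_integral_mult_le[OF g(2,1) _ h1]) measurable
        moreover have "\<bar>LINT x|leb a b. g x * m x\<bar> \<le> Bm * (LINT x|leb a b. g x)"
          by (rule abs_integral_mult_le[OF g(2,1) _ Bm]) measurable
        ultimately have "\<bar>(LINT x|leb a b. g x * (m x * dw x)) - (LINT x|leb a b. g x * m x)\<bar>
            \<le> (Bm * Bw + Bm) * (LINT x|leb a b. g x)" by (simp add: distrib_right)
        also have "\<dots> \<le> \<bar>Bm * Bw + Bm\<bar> * (LINT x|leb a b. g x)"
          using integral_nonneg_AE[OF g(1)] by (intro mult_right_mono) auto
        also have "\<dots> \<le> C1" unfolding C1_def using g(3) bc by (intro mult_left_mono) auto
        finally show ?thesis .
      qed
      finally show ?thesis by (auto intro: order_trans[OF _ mult_left_mono] simp: mult_left_mono)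
    next
      case False
      have qp: "integrable (leb a b) (\<lambda>x. (q x - p x) * \<Phi> x)"
        using p q by (intro integrable_mult_AE_bounded[OF _ _ \<Phi>L]) auto
      have "f_fun a b \<mu> \<alpha> w \<Phi> = (LINT x|leb a b. \<Phi> x * (w x * m x - \<alpha> * p x + \<alpha> * q x)) + \<alpha> * K"
        using False by (auto simp: f_fun_def Let_def p_def q_def m_def dw_def K_def bc algebra_simps)
      also have "(\<lambda>x. \<Phi> x * (w x * m x - \<alpha> * p x + \<alpha> * q x)) = (\<lambda>x. \<Phi> x * (w x * m x) + \<alpha> * ((q x - p x) * \<Phi> x))"
        by (auto simp: algebra_simps)
      also have "(LINT x|leb a b. \<Phi> x * (w x * m x) + \<alpha> * ((q x - p x) * \<Phi> x)) + \<alpha> * K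
          = (LINT x|leb a b. \<Phi> x * (w x * m x)) + \<alpha> * ((LINT x|leb a b. (q x - p x) * \<Phi> x) + K)"
        using main qp by (simp add: distrib_left)
      finally have "\<bar>f_fun a b \<mu> \<alpha> w \<Phi> - (LINT x|leb a b. \<Phi> x * (w x * m x))\<bar>
          = \<bar>\<alpha>\<bar> * \<bar>(LINT x|leb a b. (q x - p x) * \<Phi> x) + K\<bar>"
        by (simp add: abs_mult)
      also have "\<bar>(LINT x|leb a b. (q x - p x) * \<Phi> x) + K\<bar> \<le> C2"
      proof -
        have "\<bar>LINT x|leb a b. (q x - p x) * \<Phi> x\<bar> \<le> (LINT x|leb a b. \<bar>(q x - p x) * \<Phi> x\<bar>)"
          by (rule integral_abs_bound)
        also have "\<dots> = \<bar>LINT x|leb a b. \<bar>q x - p x\<bar> * \<bar>\<Phi> x\<bar>\<bar>"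
          by (subst abs_of_nonneg) (auto simp: abs_mult)
        also have "\<dots> \<le> L * (LINT x|leb a b. \<bar>q x - p x\<bar>)"
          using \<Phi>L p q by (intro abs_integral_mult_le) auto
        finally show ?thesis by (simp add: C2_def)
      qed
      finally show ?thesis by (auto intro: order_trans[OF _ mult_left_mono] simp: mult_left_mono)
    qed
  qed
  then show ?thesis unfolding m_def by blast
qed

lemma has_weak_deriv_cmult:
  assumes "has_weak_deriv a b f g"
  shows "has_weak_deriv a b (\<lambda>x. t * f x) (\<lambda>x. t * g x)"
  using assms by (auto simp: has_weak_deriv_def loc_integrable_def mult.assoc)

section \<open>Convergence along pointwise convergent sequences\<close>

lemma integral_helly_tendsto:
  assumes xs: "\<And>n. xs n \<in> helly a b" "\<And>x. x \<in> {a..b} \<Longrightarrow> (\<lambda>n. xs n x) \<longlonglongrightarrow> \<Phi> x"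
    and \<Phi>: "\<Phi> \<in> helly a b" and h: "integrable (leb a b) h"
  shows "(\<lambda>n. LINT x|leb a b. xs n x * h x) \<longlonglongrightarrow> (LINT x|leb a b. \<Phi> x * h x)"
proof (rule integral_dominated_convergence[where w="\<lambda>x. max \<bar>a\<bar> \<bar>b\<bar> * \<bar>h x\<bar>"])
  have [measurable]: "h \<in> borel_measurable (leb a b)" using h by (rule borel_measurable_integrable)
  have [measurable]: "\<Phi> \<in> borel_measurable (leb a b)" "xs n \<in> borel_measurable (leb a b)" for n
    using \<Phi> xs(1) helly_measurable by auto
  show "(\<lambda>x. \<Phi> x * h x) \<in> borel_measurable (leb a b)" "(\<lambda>x. xs n x * h x) \<in> borel_measurable (leb a b)" for n
    by measurable
  show "AE x in leb a b. (\<lambda>n. xs n x * h x) \<longlonglongrightarrow> \<Phi> x * h x"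
    by (rule AE_I2) (auto intro!: tendsto_intros xs)
  show "AE x in leb a b. norm (xs n x * h x) \<le> max \<bar>a\<bar> \<bar>b\<bar> * \<bar>h x\<bar>" for n
    by (rule AE_I2) (use helly_abs_le[OF xs(1)] in \<open>auto simp: abs_mult intro!: mult_right_mono\<close>)
qed (use h in simp)

lemma transport_cost_tendsto:
  assumes \<mu>: "finite_measure \<mu>" "sets \<mu> = sets (leb a b)"
    and xs: "\<And>n. xs n \<in> helly a b" "\<And>x. x \<in> {a..b} \<Longrightarrow> (\<lambda>n. xs n x) \<longlonglongrightarrow> \<Phi> x"
    and \<Phi>: "\<Phi> \<in> helly a b"
  shows "(\<lambda>n. LINT x|\<mu>. (xs n x - x)\<^sup>2 / 2) \<longlonglongrightarrow> (LINT x|\<mu>. (\<Phi> x - x)\<^sup>2 / 2)"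
proof (rule integral_dominated_convergence[where w="\<lambda>x. (b - a)\<^sup>2 / 2"])
  interpret finite_measure \<mu> by fact
  have space: "space \<mu> = {a..b}" using sets_eq_imp_space_eq[OF \<mu>(2)] by simp
  have meas: "\<Psi> \<in> borel_measurable \<mu>" if "\<Psi> \<in> borel_measurable (leb a b)" for \<Psi> :: "real \<Rightarrow> real"
    using that measurable_cong_sets[OF \<mu>(2) refl] by blast
  have [measurable]: "\<Phi> \<in> borel_measurable \<mu>" "xs n \<in> borel_measurable \<mu>" for n
    using \<Phi> xs(1) by (auto intro!: meas helly_measurable)
  have [measurable]: "(\<lambda>x. x) \<in> borel_measurable \<mu>"
    by (rule meas) (simp add: leb_def measurable_restrict_space1)
  show "(\<lambda>x. (\<Phi> x - x)\<^sup>2 / 2) \<in> borel_measurable \<mu>" "(\<lambda>x. (xs n x - x)\<^sup>2 / 2) \<in> borel_measurable \<mu>" for n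
    by measurable
  show "AE x in \<mu>. (\<lambda>n. (xs n x - x)\<^sup>2 / 2) \<longlonglongrightarrow> (\<Phi> x - x)\<^sup>2 / 2"
    by (rule AE_I2) (auto intro!: tendsto_intros xs simp: space)
  show "AE x in \<mu>. norm ((xs n x - x)\<^sup>2 / 2) \<le> (b - a)\<^sup>2 / 2" for n
  proof (rule AE_I2)
    fix x assume "x \<in> space \<mu>"
    then have "x \<in> {a..b}" "xs n x \<in> {a..b}" using helly_range[OF xs(1)] by (auto simp: space)
    then have "\<bar>xs n x - x\<bar> \<le> b - a" by auto
    then have "(xs n x - x)\<^sup>2 \<le> (b - a)\<^sup>2" by (metis abs_ge_zero power2_abs power_mono)
    then show "norm ((xs n x - x)\<^sup>2 / 2) \<le> (b - a)\<^sup>2 / 2" by simp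
  qed
qed (rule finite_measure.integrable_const[OF \<mu>(1)])

text \<open>The recovery maps: mixing with the identity stays in the Helly space and forces every increment of
  the map to be at least \<open>\<delta>\<close> times the increment of its argument.\<close>

lemma helly_mix_identity:
  assumes \<Phi>: "\<Phi> \<in> helly a b" and "0 \<le> \<delta>" "\<delta> \<le> 1" "a \<le> b"
  defines "\<Psi> \<equiv> (\<lambda>x\<in>{a..b}. (1 - \<delta>) * \<Phi> x + \<delta> * x)"
  shows "\<Psi> \<in> helly a b"
    and "\<And>x y. x \<in> {a..b} \<Longrightarrow> y \<in> {a..b} \<Longrightarrow> x \<le> y \<Longrightarrow> \<delta> * (y - x) \<le> \<Psi> y - \<Psi> x"
proof -
  have mono: "\<Phi> x \<le> \<Phi> y" if "x \<in> {a..b}" "y \<in> {a..b}" "x \<le> y" for x y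
    using \<Phi> that monotone_onD[of "{a..b}" "(\<le>)" "(\<le>)" \<Phi> x y] by (simp add: helly_def)
  show exp: "\<delta> * (y - x) \<le> \<Psi> y - \<Psi> x" if "x \<in> {a..b}" "y \<in> {a..b}" "x \<le> y" for x y
    using mult_left_mono[OF mono[OF that], of "1 - \<delta>"] that \<open>\<delta> \<le> 1\<close>
    by (simp add: \<Psi>_def algebra_simps)
  have mono': "\<Psi> x \<le> \<Psi> y" if "x \<in> {a..b}" "y \<in> {a..b}" "x \<le> y" for x y
  proof -
    have "0 \<le> \<delta> * (y - x)" using that \<open>0 \<le> \<delta>\<close> by simp
    then show ?thesis using exp[OF that] by linarith
  qed
  have ends: "\<Psi> a = a" "\<Psi> b = b"
    using \<Phi> \<open>a \<le> b\<close> by (auto simp: \<Psi>_def helly_def algebra_simps)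
  have "\<Psi> x \<in> {a..b}" if "x \<in> {a..b}" for x
    using mono'[of a x] mono'[of x b] that ends by auto
  then show "\<Psi> \<in> helly a b"
    using ends mono' by (auto simp: helly_def \<Psi>_def intro!: monotone_onI)
qed

theorem corollary3p4:
  fixes a b t :: real and \<mu> :: "real measure" and u0 :: "real \<Rightarrow> real" and \<alpha> :: "nat \<Rightarrow> real"
  assumes "a < b"
    and "prob_space \<mu>" and "sets \<mu> = sets (leb a b)"
    and "absolutely_continuous (leb a b) \<mu>"
    and "sobolev a b 1 (dens a b \<mu>)"
    and "0 < essinf (leb a b) (\<lambda>x. ereal (dens a b \<mu> x))"
    and "essinf (leb a b) (\<lambda>x. ereal (dens a b \<mu> x)) \<le> esssup (leb a b) (\<lambda>x. ereal (dens a b \<mu> x))"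
    and "esssup (leb a b) (\<lambda>x. ereal (dens a b \<mu> x)) < \<infinity>"
    and "sobolev a b 2 u0"
    and "t \<ge> 0"
    and "\<And>k. \<alpha> k > 0" and "\<alpha> \<longlonglongrightarrow> 0"
  shows "gamma_converges (helly_space a b)
           (\<lambda>k. F_fun a b \<mu> (\<alpha> k) (f_fun a b \<mu> (\<alpha> k) (\<lambda>x. t * u0 x)))
           (F_fun a b \<mu> 0 (f_fun a b \<mu> 0 (\<lambda>x. t * u0 x)))"
proof -
  note ab = \<open>a < b\<close> and \<alpha>_pos = \<open>\<And>k. \<alpha> k > 0\<close> and \<alpha>_lim = \<open>\<alpha> \<longlonglongrightarrow> 0\<close> and sets = \<open>sets \<mu> = sets (leb a b)\<close>
  interpret prob_space \<mu> by fact
  have fin: "finite_measure \<mu>" by (rule finite_measure_axioms)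
  define m where "m = dens a b \<mu>"
  define w where "w = (\<lambda>x. t * u0 x)"
  have dens: "\<mu> = density (leb a b) (\<lambda>x. ennreal (dens a b \<mu> x))"
    using density_dens[OF fin sets] assms by simp
  obtain m' where m': "has_weak_deriv a b (dens a b \<mu>) m'" "integrable (leb a b) m'"
    using \<open>sobolev a b 1 (dens a b \<mu>)\<close> by auto
  obtain u1 u2 where u: "integrable (leb a b) u0" "has_weak_deriv a b u0 u1" "integrable (leb a b) u1"
    "has_weak_deriv a b u1 u2" "integrable (leb a b) u2"
    using \<open>sobolev a b 2 u0\<close> by (auto simp: numeral_2_eq_2)
  have w: "integrable (leb a b) w" "has_weak_deriv a b w (\<lambda>x. t * u1 x)" "integrable (leb a b) (\<lambda>x. t * u1 x)"
    "has_weak_deriv a b (\<lambda>x. t * u1 x) (\<lambda>x. t * u2 x)" "integrable (leb a b) (\<lambda>x. t * u2 x)"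
    unfolding w_def using u by (auto intro: has_weak_deriv_cmult)
  obtain B0 where B0: "AE x in leb a b. \<bar>m x\<bar> \<le> B0"
    using weak_deriv_bounded[OF m' ab] by (auto simp: m_def)
  define B where "B = max B0 0"
  have B: "AE x in leb a b. m x \<le> B" "0 \<le> B"
    using B0 by (auto simp: B_def elim!: eventually_mono)
  have wm: "integrable (leb a b) (\<lambda>x. w x * m x)"
    by (rule integrable_mult_AE_bounded[OF w(1) _ B0]) (simp add: m_def)
  define I where "I \<Phi> = (LINT x|\<mu>. (\<Phi> x - x)\<^sup>2 / 2)" for \<Phi>
  define J where "J \<Phi> = (LINT x|leb a b. \<Phi> x * (w x * m x))" for \<Phi>
  define f where "f n = f_fun a b \<mu> (\<alpha> n) w" for n
  obtain C where C: "\<And>\<Phi> \<alpha>. \<Phi> \<in> helly a b \<Longrightarrow> \<bar>f_fun a b \<mu> \<alpha> w \<Phi> - J \<Phi>\<bar> \<le> \<bar>\<alpha>\<bar> * C"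
    using f_fun_perturbation[OF ab dens m' w] unfolding J_def m_def by blast
  \<comment> \<open>For \<open>\<alpha> = 0\<close> the perturbation estimate is an equality.\<close>
  have F0: "F_fun a b \<mu> 0 (f_fun a b \<mu> 0 w) \<Phi> = ereal (I \<Phi> - J \<Phi>)" if "\<Phi> \<in> helly a b" for \<Phi>
    using C[OF that, of 0] by (simp add: F_fun_def I_def)
  define E where "E \<Phi> = Ent a b (distr \<mu> (leb a b) \<Phi>)" for \<Phi>
  have Fn: "F_fun a b \<mu> (\<alpha> n) (f n) \<Phi> = ereal (I \<Phi>) + ereal (\<alpha> n) * E \<Phi> - ereal (f n \<Phi>)" for n \<Phi>
    using \<alpha>_pos[of n] by (simp add: F_fun_def I_def E_def)
  \<comment> \<open>The sequence \<open>e\<close> stands for a bound on \<open>\<alpha>\<close> times the entropy, from below or from above.\<close>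
  have conv: "(\<lambda>n. I (xs n) + e n - f n (xs n)) \<longlonglongrightarrow> I \<Phi> - J \<Phi>"
    if xs: "\<And>n. xs n \<in> helly a b" "\<And>x. x \<in> {a..b} \<Longrightarrow> (\<lambda>n. xs n x) \<longlonglongrightarrow> \<Phi> x"
      and \<Phi>: "\<Phi> \<in> helly a b" and e: "e \<longlonglongrightarrow> 0" for xs \<Phi> e
  proof -
    have "(\<lambda>n. \<bar>\<alpha> n\<bar> * C) \<longlonglongrightarrow> 0"
      using tendsto_mult_right[OF tendsto_rabs[OF \<alpha>_lim], of C] by simp
    then have "(\<lambda>n. f n (xs n) - J (xs n)) \<longlonglongrightarrow> 0"
      by (rule Lim_null_comparison[rotated]) (use C[OF xs(1)] in \<open>simp add: f_def\<close>)
    moreover have "(\<lambda>n. J (xs n)) \<longlonglongrightarrow> J \<Phi>"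
      unfolding J_def by (rule integral_helly_tendsto[OF xs \<Phi> wm])
    moreover have "(\<lambda>n. I (xs n)) \<longlonglongrightarrow> I \<Phi>"
      unfolding I_def by (rule transport_cost_tendsto[OF fin sets xs \<Phi>])
    ultimately have "(\<lambda>n. I (xs n) + e n - ((f n (xs n) - J (xs n)) + J (xs n))) \<longlonglongrightarrow> I \<Phi> + 0 - (0 + J \<Phi>)"
      by (intro tendsto_intros e)
    then show ?thesis by simp
  qed
  have liminf: "ereal (I \<Phi> - J \<Phi>) \<le> liminf (\<lambda>n. F_fun a b \<mu> (\<alpha> n) (f n) (xs n))"
    if xs: "\<And>n. xs n \<in> helly a b" "\<And>x. x \<in> {a..b} \<Longrightarrow> (\<lambda>n. xs n x) \<longlonglongrightarrow> \<Phi> x"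
      and \<Phi>: "\<Phi> \<in> helly a b" for xs \<Phi>
  proof -
    have "(\<lambda>n. I (xs n) + \<alpha> n * (- (b - a)) - f n (xs n)) \<longlonglongrightarrow> I \<Phi> - J \<Phi>"
      using tendsto_mult_left_zero[OF \<alpha>_lim] by (intro conv[OF xs \<Phi>])
    then have "ereal (I \<Phi> - J \<Phi>) = liminf (\<lambda>n. ereal (I (xs n) + \<alpha> n * (- (b - a)) - f n (xs n)))"
      by (intro lim_imp_Liminf[symmetric]) auto
    also have "\<dots> \<le> liminf (\<lambda>n. F_fun a b \<mu> (\<alpha> n) (f n) (xs n))"
    proof (intro Liminf_mono always_eventually allI)
      fix n
      have "ereal (\<alpha> n) * ereal (- (b - a)) \<le> ereal (\<alpha> n) * E (xs n)"
        unfolding E_def using \<alpha>_pos[of n] by (intro ereal_mult_left_mono Ent_lower_bound ab) auto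
      then have "ereal (I (xs n)) + ereal (\<alpha> n) * ereal (- (b - a)) - ereal (f n (xs n)) \<le> F_fun a b \<mu> (\<alpha> n) (f n) (xs n)"
        unfolding Fn by (intro ereal_minus_mono add_left_mono) auto
      then show "ereal (I (xs n) + \<alpha> n * (- (b - a)) - f n (xs n)) \<le> F_fun a b \<mu> (\<alpha> n) (f n) (xs n)"
        by simp
    qed
    finally show ?thesis .
  qed
  have limsup: "\<exists>xs. (\<forall>n. xs n \<in> helly a b) \<and> (\<forall>x\<in>{a..b}. (\<lambda>n. xs n x) \<longlonglongrightarrow> \<Phi> x)
      \<and> limsup (\<lambda>n. F_fun a b \<mu> (\<alpha> n) (f n) (xs n)) \<le> ereal (I \<Phi> - J \<Phi>)" if \<Phi>: "\<Phi> \<in> helly a b" for \<Phi>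
  proof -
    \<comment> \<open>The entropy bound for the pushed-forward measure grows like \<open>1 / \<delta>\<^sup>2\<close>, so \<open>\<delta>\<close> has to tend to zero more
      slowly than the square root of \<open>\<alpha>\<close>; the minimum keeps the maps in the Helly space.\<close>
    define \<delta> where "\<delta> n = min 1 (sqrt (sqrt (\<alpha> n)))" for n
    define xs where "xs n = (\<lambda>x\<in>{a..b}. (1 - \<delta> n) * \<Phi> x + \<delta> n * x)" for n
    define e where "e n = \<alpha> n * ((B / \<delta> n)\<^sup>2 * (b - a))" for n
    have \<delta>: "0 < \<delta> n" "\<delta> n \<le> 1" for n using \<alpha>_pos[of n] by (auto simp: \<delta>_def)
    have "(\<lambda>n. min 1 (sqrt (sqrt (\<alpha> n)))) \<longlonglongrightarrow> min 1 (sqrt (sqrt 0))"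
      by (intro tendsto_intros \<alpha>_lim)
    then have \<delta>_lim: "\<delta> \<longlonglongrightarrow> 0" by (simp add: \<delta>_def[abs_def])
    have helly: "xs n \<in> helly a b" for n
      unfolding xs_def using \<delta>[of n] ab by (intro helly_mix_identity \<Phi>) auto
    have lim: "(\<lambda>n. xs n x) \<longlonglongrightarrow> \<Phi> x" if "x \<in> {a..b}" for x
    proof -
      have "(\<lambda>n. (1 - \<delta> n) * \<Phi> x + \<delta> n * x) \<longlonglongrightarrow> (1 - 0) * \<Phi> x + 0 * x"
        by (intro tendsto_intros \<delta>_lim)
      then show ?thesis using that by (simp add: xs_def)
    qed
    have ratio: "\<alpha> n / (\<delta> n)\<^sup>2 = max (\<alpha> n) (sqrt (\<alpha> n))" for n
    proof (cases "\<alpha> n \<le> 1")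
      case True
      then have "(\<delta> n)\<^sup>2 = sqrt (\<alpha> n)" using \<alpha>_pos[of n] by (simp add: \<delta>_def min_def)
      moreover have "\<alpha> n \<le> sqrt (\<alpha> n)" using True \<alpha>_pos[of n]
        by (intro real_le_rsqrt) (simp add: power2_eq_square mult_left_le)
      ultimately show ?thesis using \<alpha>_pos[of n] by (simp add: real_div_sqrt)
    next
      case False
      then have "\<delta> n = 1" "sqrt (\<alpha> n) \<le> \<alpha> n" using \<alpha>_pos[of n]
        by (auto simp: \<delta>_def min_def intro!: real_le_lsqrt simp: power2_eq_square)
      then show ?thesis by simp
    qed
    have "e = (\<lambda>n. max (\<alpha> n) (sqrt (\<alpha> n)) * (B\<^sup>2 * (b - a)))"
      unfolding ratio[symmetric] by (simp add: e_def[abs_def] power_divide)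
    moreover have "(\<lambda>n. max (\<alpha> n) (sqrt (\<alpha> n)) * (B\<^sup>2 * (b - a))) \<longlonglongrightarrow> max 0 (sqrt 0) * (B\<^sup>2 * (b - a))"
      by (intro tendsto_intros \<alpha>_lim)
    ultimately have e: "e \<longlonglongrightarrow> 0" by simp
    have "limsup (\<lambda>n. F_fun a b \<mu> (\<alpha> n) (f n) (xs n)) \<le> limsup (\<lambda>n. ereal (I (xs n) + e n - f n (xs n)))"
    proof (intro Limsup_mono always_eventually allI)
      fix n
      have xm: "xs n \<in> measurable \<mu> (leb a b)"
      proof -
        have "xs n \<in> borel_measurable \<mu>"
          using helly_measurable[OF helly, of n] measurable_cong_sets[OF sets refl] by blast
        then have "xs n \<in> measurable \<mu> (restrict_space lborel {a..b})"
          by (intro measurable_restrict_space2)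
             (use helly_range[OF helly, of _ n] sets_eq_imp_space_eq[OF sets] in auto)
        then show ?thesis by (simp add: leb_def)
      qed
      have "E (xs n) \<le> ereal ((B / \<delta> n)\<^sup>2 * (b - a))"
        unfolding E_def
      proof (rule Ent_upper_bound[OF ab finite_measure_distr[OF xm]])
        fix A assume A: "A \<in> sets (leb a b)"
        show "emeasure (distr \<mu> (leb a b) (xs n)) A \<le> ennreal (B / \<delta> n) * emeasure (leb a b) A"
        proof (rule emeasure_distr_expanding_le[OF dens fin _ _ B(2) helly \<delta>(1) _ A])
          show "\<delta> n * (y - x) \<le> xs n y - xs n x" if "x \<in> {a..b}" "y \<in> {a..b}" "x \<le> y" for x y
            unfolding xs_def using \<delta>[of n] ab that by (intro helly_mix_identity(2)[OF \<Phi>]) auto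
        qed (use B(1) in \<open>auto simp: m_def\<close>)
      qed (use B(2) \<delta>(1)[of n] in auto)
      then have "ereal (\<alpha> n) * E (xs n) \<le> ereal (\<alpha> n) * ereal ((B / \<delta> n)\<^sup>2 * (b - a))"
        using \<alpha>_pos[of n] by (intro ereal_mult_left_mono) auto
      also have "\<dots> = ereal (e n)" by (simp add: e_def)
      finally have "F_fun a b \<mu> (\<alpha> n) (f n) (xs n) \<le> ereal (I (xs n)) + ereal (e n) - ereal (f n (xs n))"
        unfolding Fn by (intro ereal_minus_mono add_left_mono) auto
      then show "F_fun a b \<mu> (\<alpha> n) (f n) (xs n) \<le> ereal (I (xs n) + e n - f n (xs n))"
        by simp
    qed
    also have "\<dots> = ereal (I \<Phi> - J \<Phi>)"
      using conv[OF helly lim \<Phi> e] by (intro lim_imp_Limsup) auto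
    finally show ?thesis using helly lim by blast
  qed
  show ?thesis
    unfolding gamma_converges_def topspace_helly_space w_def[symmetric] f_def[symmetric]
  proof (intro conjI ballI allI impI)
    fix \<Phi> xs assume \<Phi>: "\<Phi> \<in> helly a b"
      and "range xs \<subseteq> helly a b \<and> limitin (helly_space a b) xs \<Phi> sequentially"
    then have xs: "\<And>n. xs n \<in> helly a b" and lim: "limitin (helly_space a b) xs \<Phi> sequentially"
      by (auto simp: image_subset_iff)
    show "F_fun a b \<mu> 0 (f_fun a b \<mu> 0 w) \<Phi> \<le> liminf (\<lambda>n. F_fun a b \<mu> (\<alpha> n) (f n) (xs n))"
      unfolding F0[OF \<Phi>] using lim by (intro liminf xs \<Phi>) (simp add: limitin_helly_space[OF xs \<Phi>])
  next
    fix \<Phi> assume \<Phi>: "\<Phi> \<in> helly a b"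
    then obtain xs where xs: "\<And>n. xs n \<in> helly a b" "\<forall>x\<in>{a..b}. (\<lambda>n. xs n x) \<longlonglongrightarrow> \<Phi> x"
      "limsup (\<lambda>n. F_fun a b \<mu> (\<alpha> n) (f n) (xs n)) \<le> ereal (I \<Phi> - J \<Phi>)"
      using limsup by blast
    then show "\<exists>xs. range xs \<subseteq> helly a b \<and> limitin (helly_space a b) xs \<Phi> sequentially
        \<and> limsup (\<lambda>n. F_fun a b \<mu> (\<alpha> n) (f n) (xs n)) \<le> F_fun a b \<mu> 0 (f_fun a b \<mu> 0 w) \<Phi>"
      unfolding F0[OF \<Phi>] using limitin_helly_space[OF xs(1) \<Phi>] by (intro exI[of _ xs]) auto
  qed
qed

end
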